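(* Let $X\subset\mathbb{R}^n$ be a compact convex set and let $f=(f_1,\dots,f_m):\mathbb{R}\times X\to\mathbb{R}^m$ and $f_0:\mathbb{R}\times X\to\mathbb{R}$ be functions such that, for every time horizon $T>0$, $f(t,x)$ and $f_0(t,x)$ are integrable with respect to $t$ on $[0,T]$ and convex with respect to $x$ for all $t\in[0,T]$. Let $x^*$ be the solution of the offline problem $$x^*=\operatorname{argmin}_{x\in X}\int_0^T f_0(t,x)\,dt\quad\text{subject to } f(t,x)\le0\ \text{ for all } t\in[0,T],$$ and suppose there is a finite constant $K$, independent of $T$, such that $K\ge f_0(t,x^* )-\min_{x\in X}f_0(t,x)$ for all $t\in[0,T]$. Suppose the environment $f$ is viable: there exists $x^\dagger\in X$ with $f(t,x^\dagger)\le0$ for all $t\ge0$. Let $\Lambda=\mathbb{R}^m_+$ and let $(x(t),\lambda(t))\in X\times\Lambda$ be the solution of the saddle point controller $$\dot x=\Pi_X\big(x,-\varepsilon(f_{0,x}(t,x)+f_x(t,x)\lambda)\big),\qquad \dot\lambda=\Pi_\Lambda\big(\lambda,\varepsilon f(t,x)\big).$$ If the gain satisfies $\varepsilon>1$, then the trajectory $x(t)$ is feasible and strongly optimal for all time horizons $T>0$. In particular, the fit $\mathcal{F}_{T,i}=\int_0^T f_i(t,x(t))\,dt$ is bounded by $$\mathcal{F}_{T,i}\le\mathcal{O}\big(\sqrt{KT},\varepsilon^0\big),\qquad i=1,\dots,m,$$ and the regret $\mathcal{R}_T=\int_0^T f_0(t,x(t))\,dt-\int_0^T f_0(t,x^*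 )\,dt$ is bounded by $$\mathcal{R}_T\le\frac1\varepsilon V_{x^*,0}(x(0),\lambda(0)),$$ where $V_{\bar x,\bar\lambda}(x,\lambda)=\frac12\big(\|x-\bar x\|^2+\|\lambda-\bar\lambda\|^2\big)$ and the notation $\mathcal{O}(\varepsilon^0)$ refers to a function that is constant with respect to the gain $\varepsilon$.
   Context: Feasible trajectory: there exist a function $h(T)$ with $\limsup_{T\to\infty}h(T)/T=0$ and a constant vector $C$ such that $\mathcal{F}_T=\int_0^T f(t,x(t))\,dt\le C\,h(T)$ for all $T$. Strongly optimal trajectory: there is a constant $C$ such that $\mathcal{R}_T\le C$ for all $T$. Inequalities between vectors are componentwise. Projection: for a closed convex set $Y\subseteq\mathbb{R}^k$, $P_Y(z)=\operatorname{argmin}_{y\in Y}\|y-z\|$ (Euclidean norm), and for $y\in Y$, $v\in\mathbb{R}^k$, $\Pi_Y(y,v)=\lim_{\delta\to0^+}\big(P_Y(y+\delta v)-y\big)/\delta$. Subgradients: for a convex $g:X\to\mathbb{R}$, a subgradient $g_x(x)$ at $x\in X$ is a vector with $g(y)\ge g(x)+g_x(x)^T(y-x)$ for all $y\in X$; subgradients are taken to exist at all points of $X$. $f_{0,x}(t,x)$ is a subgradient of $f_0(t,\cdot)$ at $x$, and $f_x(t,x)=[f_{1,x}(t,x)\ \cdots\ f_{m,x}(t,x)]\in\mathbb{R}^{n\times m}$ is the matrix whose columns are subgradients of $f_i(t,\cdot)$ at $x$. *)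

theory Defs
  imports "HOL-Analysis.Analysis"
begin

definition projected_dir :: "'a::euclidean_space set \<Rightarrow> 'a \<Rightarrow> 'a \<Rightarrow> 'a" where
  "projected_dir Y y v =
     Lim (at_right 0) (\<lambda>\<delta>. (closest_point Y (y + \<delta> *\<^sub>R v) - y) /\<^sub>R \<delta>)"

definition is_subgradient :: "'a::euclidean_space set \<Rightarrow> ('a \<Rightarrow> real) \<Rightarrow> 'a \<Rightarrow> 'a \<Rightarrow> bool" where
  "is_subgradient X g x s \<longleftrightarrow> (\<forall>y\<in>X. g y \<ge> g x + s \<bullet> (y - x))"

definition nonneg_orthant :: "(real ^ 'm) set" where
  "nonneg_orthant = {l. \<forall>i. 0 \<le> l $ i}"

(* Absolute continuity of a function on [a,b] in the epsilon-delta sense; D ranges over the finite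
   families of non-overlapping closed subintervals of [a,b]. Not to be confused with the library
   constant absolutely_continuous, which relates two measures. *)
definition abs_continuous_on_interval ::
    "real \<Rightarrow> real \<Rightarrow> (real \<Rightarrow> 'a::real_normed_vector) \<Rightarrow> bool" where
  "abs_continuous_on_interval a b g \<longleftrightarrow>
     (\<forall>\<eta>>0. \<exists>\<delta>>0. \<forall>D. D division_of \<Union>D \<and> \<Union>D \<subseteq> {a..b} \<and>
        (\<Sum>k\<in>D. Sup k - Inf k) < \<delta> \<longrightarrow> (\<Sum>k\<in>D. norm (g (Sup k) - g (Inf k))) < \<eta>)"

(* The right-hand side of the controller is discontinuous in the state and merely integrable in
   time, so solutions are understood in the sense of Caratheodory: locally absolutely continuous
   curves in X and the orthant which satisfy the differential equations for almost every time.
   The columns of fx t z are subgradients of the components of f t at z. *)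
definition saddle_point_solution ::
    "(real ^ 'n) set \<Rightarrow> (real \<Rightarrow> real ^ 'n \<Rightarrow> real ^ 'm) \<Rightarrow>
     (real \<Rightarrow> real ^ 'n \<Rightarrow> real ^ 'n) \<Rightarrow> (real \<Rightarrow> real ^ 'n \<Rightarrow> real ^ 'm ^ 'n) \<Rightarrow>
     real \<Rightarrow> (real \<Rightarrow> real ^ 'n) \<Rightarrow> (real \<Rightarrow> real ^ 'm) \<Rightarrow> bool" where
  "saddle_point_solution X f f0x fx \<epsilon> x l \<longleftrightarrow>
     (\<forall>t\<ge>0. x t \<in> X \<and> l t \<in> nonneg_orthant) \<and>
     (\<forall>T>0. abs_continuous_on_interval 0 T x \<and> abs_continuous_on_interval 0 T l) \<and>
     (AE t in lborel. t > 0 \<longrightarrow>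
        (x has_vector_derivative
           projected_dir X (x t) (- (\<epsilon> *\<^sub>R (f0x t (x t) + fx t (x t) *v l t)))) (at t) \<and>
        (l has_vector_derivative
           projected_dir nonneg_orthant (l t) (\<epsilon> *\<^sub>R f t (x t))) (at t))"

definition offline_solution ::
    "(real ^ 'n) set \<Rightarrow> (real \<Rightarrow> real ^ 'n \<Rightarrow> real ^ 'm) \<Rightarrow> (real \<Rightarrow> real ^ 'n \<Rightarrow> real) \<Rightarrow>
     real \<Rightarrow> real ^ 'n \<Rightarrow> bool" where
  "offline_solution X f f0 T y \<longleftrightarrow>
     is_arg_min (\<lambda>z. integral {0..T} (\<lambda>t. f0 t z))
       (\<lambda>z. z \<in> X \<and> (\<forall>t\<in>{0..T}. \<forall>i. f t z $ i \<le> 0)) y"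

definition fit :: "(real \<Rightarrow> real ^ 'n \<Rightarrow> real ^ 'm) \<Rightarrow> (real \<Rightarrow> real ^ 'n) \<Rightarrow> real \<Rightarrow> real ^ 'm" where
  "fit f x T = integral {0..T} (\<lambda>t. f t (x t))"

(* y T is the offline solution for the horizon T, against which the trajectory is compared. *)
definition regret :: "(real \<Rightarrow> real ^ 'n \<Rightarrow> real) \<Rightarrow> (real \<Rightarrow> real ^ 'n) \<Rightarrow> (real \<Rightarrow> real ^ 'n) \<Rightarrow>
     real \<Rightarrow> real" where
  "regret f0 y x T = integral {0..T} (\<lambda>t. f0 t (x t)) - integral {0..T} (\<lambda>t. f0 t (y T))"

definition feasible_trajectory ::
    "(real \<Rightarrow> real ^ 'n \<Rightarrow> real ^ 'm) \<Rightarrow> (real \<Rightarrow> real ^ 'n) \<Rightarrow> bool" where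
  "feasible_trajectory f x \<longleftrightarrow>
     (\<exists>(h :: real \<Rightarrow> real) (C :: real ^ 'm).
        Limsup at_top (\<lambda>T. ereal (h T / T)) = 0 \<and>
        (\<forall>T>0. \<forall>i. fit f x T $ i \<le> C $ i * h T))"

definition strongly_optimal ::
    "(real \<Rightarrow> real ^ 'n \<Rightarrow> real) \<Rightarrow> (real \<Rightarrow> real ^ 'n) \<Rightarrow> (real \<Rightarrow> real ^ 'n) \<Rightarrow> bool" where
  "strongly_optimal f0 y x \<longleftrightarrow> (\<exists>C. \<forall>T>0. regret f0 y x T \<le> C)"

definition saddle_energy :: "real ^ 'n \<Rightarrow> real ^ 'm \<Rightarrow> real ^ 'n \<Rightarrow> real ^ 'm \<Rightarrow> real" where
  "saddle_energy xb lb x l = ((norm (x - xb))\<^sup>2 + (norm (l - lb))\<^sup>2) / 2"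

end

theory Submission
  imports Defs
begin

text \<open>Projecting a velocity \<open>v\<close> at a point \<open>y\<close> of a closed convex set can only decrease its component
  along \<open>y - z\<close>, for every \<open>z\<close> in the set. Together with the subgradient inequalities this makes the
  energy \<open>V\<^bsub>z,0\<^esub>\<close> along the trajectory have derivative at most \<open>\<epsilon> (f0(t,z) - f0(t,x))\<close> whenever \<open>z\<close>
  is feasible. Integration with \<open>z = x*\<close> gives the regret bound; bounding the integrand by \<open>\<epsilon> K\<close> gives
  \<open>|\<lambda>(T)|\<^sup>2 \<le> |x(0) - x*|\<^sup>2 + |\<lambda>(0)|\<^sup>2 + 2 \<epsilon> K T\<close>, and the fit is at most \<open>\<lambda>(T) / \<epsilon>\<close> because
  \<open>\<epsilon> f \<le> d\<lambda>/dt\<close>.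

  The functions \<open>f(t,\<cdot>)\<close> may be discontinuous and unbounded on the boundary of \<open>X\<close>. Integrability along
  the trajectory therefore comes from the dynamics: the integrands are bounded below by convexity and
  above by derivatives of absolutely continuous functions.\<close>

subsection \<open>Absolutely continuous functions\<close>

text \<open>The Lipschitz estimate is asked only between values of the curve, so that maps which are
  Lipschitz merely on bounded sets, such as the squared norm, are covered.\<close>

lemma abs_continuous_on_interval_compose_lipschitz:
  fixes g :: "real \<Rightarrow> 'a::real_normed_vector" and \<phi> :: "'a \<Rightarrow> 'b::real_normed_vector"
  assumes g: "abs_continuous_on_interval a b g" and "L \<ge> 0"
    and lip: "\<And>s t. s \<in> {a..b} \<Longrightarrow> t \<in> {a..b} \<Longrightarrow> norm (\<phi> (g s) - \<phi> (g t)) \<le> L * norm (g s - g t)"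
  shows "abs_continuous_on_interval a b (\<lambda>t. \<phi> (g t))"
  unfolding abs_continuous_on_interval_def
proof (intro allI impI)
  fix \<eta> :: real assume "\<eta> > 0"
  \<comment> \<open>Dividing by \<open>L + 1\<close> avoids a zero denominator when
    \<open>L = 0\<close>.\<close>
  then have "\<eta> / (L + 1) > 0"
    using \<open>L \<ge> 0\<close> by simp
  then obtain \<delta> where "\<delta> > 0" and \<delta>: "\<And>D. D division_of \<Union>D \<Longrightarrow> \<Union>D \<subseteq> {a..b} \<Longrightarrow>
        (\<Sum>k\<in>D. Sup k - Inf k) < \<delta> \<Longrightarrow> (\<Sum>k\<in>D. norm (g (Sup k) - g (Inf k))) < \<eta> / (L + 1)"
    using g unfolding abs_continuous_on_interval_def by meson
  have "(\<Sum>k\<in>D. norm (\<phi> (g (Sup k)) - \<phi> (g (Inf k)))) < \<eta>"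
    if D: "D division_of \<Union>D" "\<Union>D \<subseteq> {a..b}" "(\<Sum>k\<in>D. Sup k - Inf k) < \<delta>" for D
  proof -
    have "(\<Sum>k\<in>D. norm (\<phi> (g (Sup k)) - \<phi> (g (Inf k)))) \<le> (\<Sum>k\<in>D. L * norm (g (Sup k) - g (Inf k)))"
    proof (rule sum_mono)
      fix k assume "k \<in> D"
      then obtain u v where k: "k = {u..v}" "k \<noteq> {}"
        using division_ofD(3,4)[OF D(1)] by (metis box_real(2))
      then have "Sup k \<in> k" "Inf k \<in> k" by auto
      then show "norm (\<phi> (g (Sup k)) - \<phi> (g (Inf k))) \<le> L * norm (g (Sup k) - g (Inf k))"
        using \<open>k \<in> D\<close> D(2) by (intro lip) auto
    qed
    also have "\<dots> \<le> (L + 1) * (\<Sum>k\<in>D. norm (g (Sup k) - g (Inf k)))"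
      unfolding sum_distrib_left by (intro sum_mono mult_right_mono) auto
    also have "\<dots> < (L + 1) * (\<eta> / (L + 1))"
      using \<delta>[OF D] \<open>L \<ge> 0\<close> by (intro mult_strict_left_mono) auto
    also have "\<dots> = \<eta>"
      using \<open>L \<ge> 0\<close> by simp
    finally show ?thesis .
  qed
  with \<open>\<delta> > 0\<close> show "\<exists>\<delta>>0. \<forall>D. D division_of \<Union>D \<and> \<Union>D \<subseteq> {a..b} \<and> (\<Sum>k\<in>D. Sup k - Inf k) < \<delta> \<longrightarrow>
      (\<Sum>k\<in>D. norm (\<phi> (g (Sup k)) - \<phi> (g (Inf k)))) < \<eta>"
    by blast
qed

lemma abs_continuous_on_interval_add:
  assumes f: "abs_continuous_on_interval a b f" and g: "abs_continuous_on_interval a b g"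
  shows "abs_continuous_on_interval a b (\<lambda>t. f t + g t)"
  unfolding abs_continuous_on_interval_def
proof (intro allI impI)
  fix \<eta> :: real assume "\<eta> > 0"
  then have "\<eta> / 2 > 0"
    by simp
  obtain \<delta>1 where "\<delta>1 > 0"
    and \<delta>1: "\<And>D. D division_of \<Union>D \<Longrightarrow> \<Union>D \<subseteq> {a..b} \<Longrightarrow>
        (\<Sum>k\<in>D. Sup k - Inf k) < \<delta>1 \<Longrightarrow> (\<Sum>k\<in>D. norm (f (Sup k) - f (Inf k))) < \<eta> / 2"
    using f \<open>\<eta> / 2 > 0\<close> unfolding abs_continuous_on_interval_def by meson
  obtain \<delta>2 where "\<delta>2 > 0"
    and \<delta>2: "\<And>D. D division_of \<Union>D \<Longrightarrow> \<Union>D \<subseteq> {a..b} \<Longrightarrow>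
        (\<Sum>k\<in>D. Sup k - Inf k) < \<delta>2 \<Longrightarrow> (\<Sum>k\<in>D. norm (g (Sup k) - g (Inf k))) < \<eta> / 2"
    using g \<open>\<eta> / 2 > 0\<close> unfolding abs_continuous_on_interval_def by meson
  have "(\<Sum>k\<in>D. norm (f (Sup k) + g (Sup k) - (f (Inf k) + g (Inf k)))) < \<eta>"
    if D: "D division_of \<Union>D" "\<Union>D \<subseteq> {a..b}" "(\<Sum>k\<in>D. Sup k - Inf k) < min \<delta>1 \<delta>2" for D
  proof -
    have "(\<Sum>k\<in>D. norm (f (Sup k) + g (Sup k) - (f (Inf k) + g (Inf k))))
        \<le> (\<Sum>k\<in>D. norm (f (Sup k) - f (Inf k)) + norm (g (Sup k) - g (Inf k)))"
      by (intro sum_mono norm_diff_triangle_ineq)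
    also have "\<dots> < \<eta>"
      using \<delta>1[of D] \<delta>2[of D] D by (simp add: sum.distrib)
    finally show ?thesis .
  qed
  with \<open>\<delta>1 > 0\<close> \<open>\<delta>2 > 0\<close>
  show "\<exists>\<delta>>0. \<forall>D. D division_of \<Union>D \<and> \<Union>D \<subseteq> {a..b} \<and> (\<Sum>k\<in>D. Sup k - Inf k) < \<delta> \<longrightarrow>
      (\<Sum>k\<in>D. norm (f (Sup k) + g (Sup k) - (f (Inf k) + g (Inf k)))) < \<eta>"
    by (intro exI[of _ "min \<delta>1 \<delta>2"]) auto
qed

lemma abs_continuous_on_interval_imp_continuous_on:
  assumes g: "abs_continuous_on_interval a b g"
  shows "continuous_on {a..b} g"
  unfolding continuous_on_iff
proof (intro ballI allI impI)
  fix s \<eta> :: real assume s: "s \<in> {a..b}" and "\<eta> > 0"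
  then obtain \<delta> where "\<delta> > 0" and \<delta>: "\<And>D. D division_of \<Union>D \<Longrightarrow> \<Union>D \<subseteq> {a..b} \<Longrightarrow>
        (\<Sum>k\<in>D. Sup k - Inf k) < \<delta> \<Longrightarrow> (\<Sum>k\<in>D. norm (g (Sup k) - g (Inf k))) < \<eta>"
    using g unfolding abs_continuous_on_interval_def by meson
  \<comment> \<open>A single interval is a division, and its only summand is the increment.\<close>
  have *: "norm (g v - g u) < \<eta>" if "u \<in> {a..b}" "v \<in> {a..b}" "u \<le> v" "v - u < \<delta>" for u v
    using that \<delta>[of "{{u..v}}"] division_of_self[of u v] by auto
  have "dist (g t) (g s) < \<eta>" if "t \<in> {a..b}" "dist t s < \<delta>" for t
    using *[of s t] *[of t s] s that
    by (cases "s \<le> t") (auto simp: dist_norm norm_minus_commute)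
  with \<open>\<delta> > 0\<close> show "\<exists>d>0. \<forall>t\<in>{a..b}. dist t s < d \<longrightarrow> dist (g t) (g s) < \<eta>"
    by blast
qed

text \<open>The passage from tagged intervals to the untagged divisions of absolute continuity: the
  intervals do not overlap, so their total length is the measure of their union, which is below
  \<delta> inside \<open>U\<close>.\<close>

lemma abs_continuous_sum_on_small_cover:
  fixes g :: "real \<Rightarrow> 'a::real_normed_vector"
  assumes \<delta>: "\<And>D. D division_of \<Union>D \<Longrightarrow> \<Union>D \<subseteq> {a..b} \<Longrightarrow>
        (\<Sum>k\<in>D. Sup k - Inf k) < \<delta> \<Longrightarrow> (\<Sum>k\<in>D. norm (g (Sup k) - g (Inf k))) < \<eta>"
    and q: "q tagged_partial_division_of {a..b}"
    and U: "U \<in> lmeasurable" "measure lebesgue U < \<delta>" "\<Union>(snd ` q) \<subseteq> U"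
  shows "(\<Sum>(t, k)\<in>q. norm (g (Sup k) - g (Inf k))) < \<eta>"
proof -
  have tag: "q tagged_division_of \<Union>(snd ` q)"
    by (rule tagged_partial_division_of_Union_self[OF q])
  have div: "snd ` q division_of \<Union>(snd ` q)"
    by (rule partial_division_of_tagged_division[OF q])
  have "(\<Sum>k\<in>snd ` q. Sup k - Inf k) = (\<Sum>k\<in>snd ` q. measure lebesgue k)"
  proof (rule sum.cong[OF refl])
    fix k assume "k \<in> snd ` q"
    then obtain u v where "k = {u..v}" "k \<noteq> {}"
      using division_ofD(3,4)[OF div] by (metis box_real(2))
    then show "Sup k - Inf k = measure lebesgue k"
      by auto
  qed
  also have "\<dots> = measure lebesgue (\<Union>(snd ` q))"
    by (rule content_division[OF div])
  also have "\<dots> \<le> measure lebesgue U"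
    using U lmeasurable_division[OF div] by (intro measure_mono_fmeasurable) auto
  finally have small: "(\<Sum>k\<in>snd ` q. Sup k - Inf k) < \<delta>"
    using U by linarith
  \<comment> \<open>\<open>Sup {}\<close> and \<open>Inf {}\<close> carry no meaning here, so
    \<open>F\<close> is 0 on the empty set. It then vanishes on every interval without interior, and
    only such intervals can repeat under different tags.\<close>
  define F where "F k = (if k = {} then 0 else norm (g (Sup k) - g (Inf k)))" for k
  have "(\<Sum>(t, k)\<in>q. norm (g (Sup k) - g (Inf k))) = (\<Sum>(t, k)\<in>q. F k)"
    using tagged_partial_division_ofD(2)[OF q] by (intro sum.cong) (fastforce simp: F_def)+
  also have "\<dots> = (\<Sum>k\<in>snd ` q. F k)"
  proof (rule sum.over_tagged_division_lemma[OF tag])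
    fix u v :: real assume "box u v = {}"
    then show "F (cbox u v) = 0"
      by (cases "u = v") (auto simp: box_real F_def)
  qed
  also have "\<dots> = (\<Sum>k\<in>snd ` q. norm (g (Sup k) - g (Inf k)))"
    using division_ofD(3)[OF div] by (intro sum.cong) (auto simp: F_def)
  also have "\<dots> < \<eta>"
  proof (intro \<delta> div small Union_least)
    fix k assume "k \<in> snd ` q"
    then obtain t where "(t, k) \<in> q"
      by auto
    then show "k \<subseteq> {a..b}"
      by (rule tagged_partial_division_ofD(3)[OF q])
  qed
  finally show ?thesis .
qed

text \<open>Intervals tagged in \<open>N\<close> lie in an open set of small measure, so absolute continuity makes their
  total increment small; the other tags are handled by differentiability.\<close>
lemma fundamental_theorem_of_calculus_abs_continuous:
  fixes g :: "real \<Rightarrow> 'a::banach"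
  assumes "a \<le> b" and ac: "abs_continuous_on_interval a b g" and N: "negligible N"
    and der: "\<And>t. t \<in> {a..b} - N \<Longrightarrow> (g has_vector_derivative g' t) (at t within {a..b})"
  shows "(g' has_integral (g b - g a)) {a..b}"
proof -
  \<comment> \<open>With the value 0 on \<open>N\<close>, intervals tagged in \<open>N\<close>
    contribute only increments of \<open>g\<close> to the error.\<close>
  define h where "h t = (if t \<in> N then 0 else g' t)" for t
  have "(h has_integral (g b - g a)) {a..b}"
    unfolding has_integral_real
  proof (intro allI impI)
    fix e :: real assume "e > 0"
    \<comment> \<open>The linearisation errors add up to at most \<open>c * (b - a)\<close>, within
      half the tolerance. The summand 1 keeps the denominator positive when
      \<open>a = b\<close>.\<close>
    define c where "c = e / (2 * (b - a + 1))"
    have "c > 0"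
      using \<open>e > 0\<close> \<open>a \<le> b\<close> by (simp add: c_def)
    have cb: "c * (b - a) \<le> e / 2"
      using \<open>e > 0\<close> \<open>a \<le> b\<close> by (simp add: c_def field_simps)
    obtain \<delta> where "\<delta> > 0" and \<delta>: "\<And>D. D division_of \<Union>D \<Longrightarrow> \<Union>D \<subseteq> {a..b} \<Longrightarrow>
        (\<Sum>k\<in>D. Sup k - Inf k) < \<delta> \<Longrightarrow> (\<Sum>k\<in>D. norm (g (Sup k) - g (Inf k))) < e / 2"
      using ac \<open>e > 0\<close> unfolding abs_continuous_on_interval_def by (meson half_gt_zero)
    obtain U where "open U" "N \<subseteq> U" "U - N \<in> lmeasurable" "emeasure lebesgue (U - N) < ennreal \<delta>"
      using sets_lebesgue_outer_open[OF fmeasurableD[OF negligible_imp_measurable[OF N]] \<open>\<delta> > 0\<close>] .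
    have U: "U \<in> lmeasurable" "measure lebesgue U < \<delta>"
    proof -
      have "(U - N) \<union> N \<in> lmeasurable"
        by (intro fmeasurable.Un \<open>U - N \<in> lmeasurable\<close> negligible_imp_measurable N)
      moreover have "(U - N) \<union> N = U"
        using \<open>N \<subseteq> U\<close> by blast
      ultimately show "U \<in> lmeasurable"
        by simp
      have "measure lebesgue U = measure lebesgue (U - N)"
        using N \<open>U \<in> lmeasurable\<close>
        by (simp add: measure_Diff_null_set negligible_iff_null_sets fmeasurableD)
      then show "measure lebesgue U < \<delta>"
        using \<open>emeasure lebesgue (U - N) < ennreal \<delta>\<close> \<open>U - N \<in> lmeasurable\<close>
        by (simp add: emeasure_eq_measure2 ennreal_less_iff)
    qed
    \<comment> \<open>The radius of the gauge: intervals tagged in \<open>N\<close> stay inside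
      \<open>U\<close>, and those tagged elsewhere stay where \<open>g\<close> is linear up to slope
      \<open>c\<close>.\<close>
    have "\<exists>d>0. (t \<in> N \<longrightarrow> ball t d \<subseteq> U) \<and> (t \<in> {a..b} - N \<longrightarrow>
         (\<forall>y\<in>{a..b}. norm (y - t) < d \<longrightarrow> norm (g y - g t - (y - t) *\<^sub>R g' t) \<le> c * norm (y - t)))" for t
    proof (cases "t \<in> N")
      case True
      then show ?thesis
        using \<open>open U\<close> \<open>N \<subseteq> U\<close> by (auto elim!: openE)
    next
      case False
      show ?thesis
      proof (cases "t \<in> {a..b}")
        case True
        then show ?thesis
          using False der[of t] \<open>c > 0\<close>
          unfolding has_vector_derivative_def has_derivative_within_alt by blast
      qed (use False in \<open>auto intro: exI[of _ 1]\<close>)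
    qed
    then obtain d where d: "\<And>t. d t > 0" "\<And>t. t \<in> N \<Longrightarrow> ball t (d t) \<subseteq> U"
      and der': "\<And>t y. \<lbrakk>t \<in> {a..b} - N; y \<in> {a..b}; norm (y - t) < d t\<rbrakk>
                        \<Longrightarrow> norm (g y - g t - (y - t) *\<^sub>R g' t) \<le> c * norm (y - t)"
      by metis
    have "norm ((\<Sum>(t, k)\<in>p. measure lborel k *\<^sub>R h t) - (g b - g a)) < e"
      if p: "p tagged_division_of {a..b}" and fine: "(\<lambda>t. ball t (d t)) fine p" for p
    proof -
      have "finite p"
        by (rule tagged_division_ofD(1)[OF p])
      define q where "q = {(t, k) \<in> p. t \<in> N}"
      have "q \<subseteq> p"
        by (auto simp: q_def)
      then have q: "q tagged_partial_division_of {a..b}"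
        using p by (auto simp: tagged_division_of_def intro: tagged_partial_division_subset)
      have bound: "norm (measure lborel k *\<^sub>R h t - (g (Sup k) - g (Inf k))) \<le> c * (Sup k - Inf k)"
        if tk: "(t, k) \<in> p - q" for t k
      proof -
        have t: "t \<in> k" "k \<subseteq> {a..b}" "t \<notin> N"
          using tk tagged_division_ofD(2,3)[OF p, of t k] by (auto simp: q_def)
        obtain u v where k: "k = {u..v}"
          using tagged_division_ofD(4)[OF p] tk by (metis DiffD1 box_real(2))
        have uv: "u \<le> v" "u \<in> k" "v \<in> k"
          using t k by auto
        have sub: "k \<subseteq> ball t (d t)"
          using fine tk by blast
        \<comment> \<open>The increment is split at the tag \<open>t\<close>, which lies between
          \<open>u\<close> and \<open>v\<close>, so the two errors add up to
          \<open>c * (v - u)\<close>.\<close>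
        have "norm ((v - u) *\<^sub>R g' t - (g v - g u))
            = norm (g u - g t - (u - t) *\<^sub>R g' t - (g v - g t - (v - t) *\<^sub>R g' t))"
          by (auto simp: algebra_simps)
        also have "\<dots> \<le> norm (g u - g t - (u - t) *\<^sub>R g' t) + norm (g v - g t - (v - t) *\<^sub>R g' t)"
          by (rule norm_triangle_ineq4)
        also have "\<dots> \<le> c * norm (u - t) + c * norm (v - t)"
          using t uv sub
          by (intro add_mono der') (auto simp: dist_real_def)
        also have "\<dots> = c * (v - u)"
          using t k by (auto simp: field_simps)
        finally show ?thesis
          using uv t by (simp add: k h_def)
      qed
      have pq: "(\<Sum>x\<in>p. F x) = (\<Sum>x\<in>p - q. F x) + (\<Sum>x\<in>q. F x)" for F :: "_ \<Rightarrow> 'c::comm_monoid_add"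
        by (rule sum.subset_diff[OF \<open>q \<subseteq> p\<close> \<open>finite p\<close>])
      have "norm (\<Sum>(t, k)\<in>p - q. measure lborel k *\<^sub>R h t - (g (Sup k) - g (Inf k)))
          \<le> (\<Sum>(t, k)\<in>p - q. c * (Sup k - Inf k))"
        using bound by (intro sum_norm_le) auto
      also have "\<dots> \<le> (\<Sum>(t, k)\<in>p. c * (Sup k - Inf k))"
      proof (rule sum_mono2[OF \<open>finite p\<close>])
        fix x assume "x \<in> p - (p - q)"
        then obtain t k where "x = (t, k)" "(t, k) \<in> p"
          by (cases x) auto
        moreover obtain u v where "k = {u..v}"
          using tagged_division_ofD(4)[OF p] \<open>(t, k) \<in> p\<close> by (metis box_real(2))
        ultimately show "0 \<le> (case x of (t, k) \<Rightarrow> c * (Sup k - Inf k))"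
          using tagged_division_ofD(2)[OF p, of t k] \<open>c > 0\<close> by auto
      qed auto
      also have "\<dots> = c * (b - a)"
        using additive_tagged_division_1[OF \<open>a \<le> b\<close> p, of "\<lambda>x. x"]
        by (simp add: sum_distrib_left[symmetric] case_prod_unfold)
      finally have 1: "norm (\<Sum>(t, k)\<in>p - q. measure lborel k *\<^sub>R h t - (g (Sup k) - g (Inf k))) \<le> e / 2"
        using cb by linarith
      have "norm (\<Sum>(t, k)\<in>q. measure lborel k *\<^sub>R h t - (g (Sup k) - g (Inf k)))
          \<le> (\<Sum>(t, k)\<in>q. norm (g (Sup k) - g (Inf k)))"
        by (rule sum_norm_le) (auto simp: q_def h_def norm_minus_commute)
      also have "\<dots> < e / 2"
      proof (rule abs_continuous_sum_on_small_cover[OF \<delta> q U])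
        show "\<Union>(snd ` q) \<subseteq> U"
          using fine d(2) by (fastforce simp: q_def)
      qed auto
      finally have 2: "norm (\<Sum>(t, k)\<in>q. measure lborel k *\<^sub>R h t - (g (Sup k) - g (Inf k))) < e / 2" .
      have "(\<Sum>(t, k)\<in>p. measure lborel k *\<^sub>R h t) - (g b - g a)
          = (\<Sum>(t, k)\<in>p. measure lborel k *\<^sub>R h t - (g (Sup k) - g (Inf k)))"
        using additive_tagged_division_1[OF \<open>a \<le> b\<close> p, of g]
        by (simp add: case_prod_unfold sum_subtractf)
      also have "norm \<dots> < e"
        unfolding pq using 1 2 by (intro norm_triangle_lt) linarith
      finally show ?thesis .
    qed
    moreover have "gauge (\<lambda>t. ball t (d t))"
      using d(1) by (rule gauge_ball_dependent[OF allI])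
    ultimately show "\<exists>\<gamma>. gauge \<gamma> \<and> (\<forall>p. p tagged_division_of {a..b} \<and> \<gamma> fine p \<longrightarrow>
        norm ((\<Sum>(t, k)\<in>p. measure lborel k *\<^sub>R h t) - (g b - g a)) < e)"
      by blast
  qed
  then show ?thesis
    by (rule has_integral_spike[OF N, rotated]) (simp add: h_def)
qed

section \<open>Increments and integrability from one-sided derivative bounds\<close>

lemma abs_continuous_increment_le_integral:
  fixes g :: "real \<Rightarrow> real"
  assumes "a \<le> b" and ac: "abs_continuous_on_interval a b g" and N: "negligible N"
    and der: "\<And>t. t \<in> {a..b} - N \<Longrightarrow> (g has_vector_derivative g' t) (at t)"
    and le: "\<And>t. t \<in> {a..b} - N \<Longrightarrow> g' t \<le> h t" and h: "h integrable_on {a..b}"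
  shows "g b - g a \<le> integral {a..b} h"
proof -
  \<comment> \<open>Taking \<open>h\<close> in place of \<open>g'\<close> on \<open>N\<close> makes
    the comparison with \<open>h\<close> hold at every point of the interval.\<close>
  have "((\<lambda>t. if t \<in> N then h t else g' t) has_integral (g b - g a)) {a..b}"
    using der by (intro fundamental_theorem_of_calculus_abs_continuous[OF \<open>a \<le> b\<close> ac N])
      (auto intro: has_vector_derivative_at_within)
  then show ?thesis
    using le by (intro has_integral_le[OF _ integrable_integral[OF h]]) auto
qed

text \<open>The fundamental theorem gives only a gauge integral of the derivative. Below an
  absolutely integrable majorant this suffices, since the difference is nonnegative and
  integrable.\<close>

lemma abs_continuous_derivative_absolutely_integrable:
  fixes g :: "real \<Rightarrow> real"
  assumes "a \<le> b" and ac: "abs_continuous_on_interval a b g" and N: "negligible N"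
    and der: "\<And>t. t \<in> {a..b} - N \<Longrightarrow> (g has_vector_derivative g' t) (at t)"
    and le: "\<And>t. t \<in> {a..b} - N \<Longrightarrow> g' t \<le> h t" and h: "h absolutely_integrable_on {a..b}"
  shows "g' absolutely_integrable_on {a..b}"
proof -
  have "((\<lambda>t. if t \<in> N then h t else g' t) has_integral (g b - g a)) {a..b}"
    using der by (intro fundamental_theorem_of_calculus_abs_continuous[OF \<open>a \<le> b\<close> ac N])
      (auto intro: has_vector_derivative_at_within)
  then have "(\<lambda>t. if t \<in> N then h t else g' t) absolutely_integrable_on {a..b}"
    using le by (intro absolutely_integrable_absolutely_integrable_ubound[OF _ h]) auto
  then show ?thesis
    by (rule absolutely_integrable_spike[OF _ N]) auto
qed

section \<open>Half the squared distance to a fixed point along a curve\<close>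

lemma half_sq_norm_diff_le:
  fixes u v :: "'a::real_inner"
  assumes "norm u \<le> M" "norm v \<le> M"
  shows "\<bar>(norm u)\<^sup>2 / 2 - (norm v)\<^sup>2 / 2\<bar> \<le> M * norm (u - v)"
proof -
  have "(norm u)\<^sup>2 / 2 - (norm v)\<^sup>2 / 2 = ((u + v) \<bullet> (u - v)) / 2"
    by (simp add: power2_norm_eq_inner inner_add_left inner_add_right inner_diff_left
        inner_diff_right inner_commute diff_divide_distrib)
  also have "\<bar>\<dots>\<bar> \<le> norm (u + v) * norm (u - v) / 2"
    using Cauchy_Schwarz_ineq2[of "u + v" "u - v"] by simp
  also have "\<dots> \<le> (2 * M) * norm (u - v) / 2"
    using assms norm_triangle_ineq[of u v] by (intro divide_right_mono mult_right_mono) auto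
  finally show ?thesis by simp
qed

lemma abs_continuous_on_interval_half_sq_norm:
  fixes x :: "real \<Rightarrow> 'a::euclidean_space"
  assumes x: "abs_continuous_on_interval a b x"
  shows "abs_continuous_on_interval a b (\<lambda>t. (norm (x t - z))\<^sup>2 / 2)"
proof -
  \<comment> \<open>Continuity bounds the curve, and on a ball of radius \<open>M\<close> half the
    squared norm is Lipschitz with constant \<open>M\<close>.\<close>
  have "compact ((\<lambda>t. x t - z) ` {a..b})"
    using abs_continuous_on_interval_imp_continuous_on[OF x]
    by (intro compact_continuous_image continuous_intros) auto
  then obtain M where "M > 0" and M: "\<And>t. t \<in> {a..b} \<Longrightarrow> norm (x t - z) \<le> M"
    using compact_imp_bounded bounded_pos by (metis imageI)
  show ?thesis
  proof (rule abs_continuous_on_interval_compose_lipschitz[OF x, of M])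
    fix s t assume "s \<in> {a..b}" "t \<in> {a..b}"
    then show "norm ((norm (x s - z))\<^sup>2 / 2 - (norm (x t - z))\<^sup>2 / 2) \<le> M * norm (x s - x t)"
      using half_sq_norm_diff_le[OF M M, of s t] by simp
  qed (use \<open>M > 0\<close> in simp)
qed

lemma has_vector_derivative_half_sq_norm:
  fixes x :: "real \<Rightarrow> 'a::euclidean_space"
  assumes "(x has_vector_derivative x') (at t)"
  shows "((\<lambda>t. (norm (x t - z))\<^sup>2 / 2) has_vector_derivative (x t - z) \<bullet> x') (at t)"
proof -
  have d: "(x has_derivative (\<lambda>h. h *\<^sub>R x')) (at t)"
    using assms by (simp add: has_vector_derivative_def)
  have "((\<lambda>t. ((x t - z) \<bullet> (x t - z)) / 2) has_derivative (\<lambda>h. h *\<^sub>R ((x t - z) \<bullet> x'))) (at t)"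
    by (rule derivative_eq_intros d refl)+ (auto simp: inner_commute)
  then show ?thesis
    by (simp add: has_vector_derivative_def power2_norm_eq_inner)
qed

subsection \<open>Directional derivatives of projections\<close>

text \<open>The obtuse-angle inequality of nearest points, rescaled from \<open>Y\<close> to (Y - y)
  / \<delta>, where the difference quotient is the point nearest to \<open>v\<close>.\<close>

lemma closest_point_scaled_translate:
  fixes Y :: "'a::euclidean_space set"
  assumes Y: "closed Y" "convex Y" "Y \<noteq> {}" and "\<delta> > 0"
    and w: "y + \<delta> *\<^sub>R w \<in> Y"
  shows "(v - (closest_point Y (y + \<delta> *\<^sub>R v) - y) /\<^sub>R \<delta>) \<bullet> (w - (closest_point Y (y + \<delta> *\<^sub>R v) - y) /\<^sub>R \<delta>) \<le> 0"
proof -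
  define p where "p = (closest_point Y (y + \<delta> *\<^sub>R v) - y) /\<^sub>R \<delta>"
  have p: "closest_point Y (y + \<delta> *\<^sub>R v) = y + \<delta> *\<^sub>R p"
    using \<open>\<delta> > 0\<close> by (simp add: p_def)
  have "(y + \<delta> *\<^sub>R v - (y + \<delta> *\<^sub>R p)) \<bullet> (y + \<delta> *\<^sub>R w - (y + \<delta> *\<^sub>R p)) \<le> 0"
    using closest_point_dot[OF Y(2,1) w, of "y + \<delta> *\<^sub>R v"] unfolding p .
  also have "y + \<delta> *\<^sub>R v - (y + \<delta> *\<^sub>R p) = \<delta> *\<^sub>R (v - p)"
    by (simp add: algebra_simps)
  also have "y + \<delta> *\<^sub>R w - (y + \<delta> *\<^sub>R p) = \<delta> *\<^sub>R (w - p)"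
    by (simp add: algebra_simps)
  finally have "\<delta> * \<delta> * ((v - p) \<bullet> (w - p)) \<le> 0"
    by (simp add: mult.assoc)
  then show ?thesis
    unfolding p_def[symmetric] using \<open>\<delta> > 0\<close> by (simp add: mult_le_0_iff)
qed

text \<open>To be read with \<open>d\<close> nearest to \<open>v\<close> in a convex set containing
  \<open>p\<close>, and \<open>p\<close> nearest in a smaller one containing \<open>w\<close>. Then
  \<open>p\<close> is no farther from \<open>v\<close> than \<open>w\<close> is, and the obtuse
  angle at \<open>d\<close> turns nearly equal distances into closeness of \<open>p\<close> and
  \<open>d\<close>.\<close>

lemma norm_obtuse_diff_le:
  fixes d :: "'a::real_inner"
  assumes "(v - d) \<bullet> (p - d) \<le> 0" "(v - p) \<bullet> (w - p) \<le> 0"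
  shows "(norm (p - d))\<^sup>2 \<le> 2 * norm (v - d) * norm (w - d) + (norm (w - d))\<^sup>2"
proof -
  have "(norm (v - p))\<^sup>2 \<le> (norm (v - w))\<^sup>2"
  proof -
    have "(norm (v - w))\<^sup>2 = (norm (v - p))\<^sup>2 - 2 * ((v - p) \<bullet> (w - p)) + (norm (w - p))\<^sup>2"
      by (simp add: power2_norm_eq_inner inner_diff_left inner_diff_right inner_commute)
    then show ?thesis
      using assms(2) zero_le_power2[of "norm (w - p)"] by linarith
  qed
  also have "\<dots> = (norm (v - d))\<^sup>2 - 2 * ((v - d) \<bullet> (w - d)) + (norm (w - d))\<^sup>2"
    by (simp add: power2_norm_eq_inner inner_diff_left inner_diff_right inner_commute)
  also have "\<dots> \<le> (norm (v - d))\<^sup>2 + 2 * norm (v - d) * norm (w - d) + (norm (w - d))\<^sup>2"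
    using Cauchy_Schwarz_ineq2[of "v - d" "w - d"] by (simp add: abs_le_iff)
  finally have "(norm (v - p))\<^sup>2 \<le> \<dots>" .
  moreover have "(norm (v - p))\<^sup>2 = (norm (v - d))\<^sup>2 - 2 * ((v - d) \<bullet> (p - d)) + (norm (p - d))\<^sup>2"
    by (simp add: power2_norm_eq_inner inner_diff_left inner_diff_right inner_commute)
  ultimately show ?thesis
    using assms(1) by linarith
qed

text \<open>The difference quotient is the projection of \<open>v\<close> onto \<open>(Y - y) / \<delta>\<close>. These sets increase as
  \<open>\<delta>\<close> decreases, so the quotients converge to the projection of \<open>v\<close> onto the closure of their union,
  the tangent cone of \<open>Y\<close> at \<open>y\<close>.\<close>
lemma projected_dir_tendsto:
  fixes Y :: "'a::euclidean_space set"
  assumes Y: "closed Y" "convex Y" and y: "y \<in> Y"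
  shows "((\<lambda>\<delta>. (closest_point Y (y + \<delta> *\<^sub>R v) - y) /\<^sub>R \<delta>) \<longlongrightarrow> projected_dir Y y v) (at_right 0)"
proof -
  define q where "q \<delta> = (closest_point Y (y + \<delta> *\<^sub>R v) - y) /\<^sub>R \<delta>" for \<delta> :: real
  define S where "S = {w. \<exists>\<delta>>0. y + \<delta> *\<^sub>R w \<in> Y}"
  \<comment> \<open>By convexity the segment from \<open>y\<close> to
    \<open>y + \<delta> *\<^sub>R w\<close> stays in \<open>Y\<close>; this is the monotonicity of
    the rescaled sets.\<close>
  have shrink: "y + \<delta>' *\<^sub>R w \<in> Y" if "0 \<le> \<delta>'" "\<delta>' \<le> \<delta>" "y + \<delta> *\<^sub>R w \<in> Y" for \<delta> \<delta>' w
  proof (cases "\<delta> = 0")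
    case False
    then have "y + \<delta>' *\<^sub>R w = (1 - \<delta>' / \<delta>) *\<^sub>R y + (\<delta>' / \<delta>) *\<^sub>R (y + \<delta> *\<^sub>R w)"
      using that by (simp add: algebra_simps)
    also have "\<dots> \<in> Y"
      using that False y by (intro convexD[OF Y(2)]) auto
    finally show ?thesis .
  qed (use that y in auto)
  have "convex S"
  proof (rule convexI)
    fix w1 w2 and a b :: real
    assume "w1 \<in> S" "w2 \<in> S" and ab: "0 \<le> a" "0 \<le> b" "a + b = 1"
    then obtain \<delta>1 \<delta>2 where d: "\<delta>1 > 0" "\<delta>2 > 0" "y + \<delta>1 *\<^sub>R w1 \<in> Y" "y + \<delta>2 *\<^sub>R w2 \<in> Y"
      by (auto simp: S_def)
    define \<delta> where "\<delta> = min \<delta>1 \<delta>2"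
    have "y + \<delta> *\<^sub>R (a *\<^sub>R w1 + b *\<^sub>R w2) = (a + b) *\<^sub>R y + \<delta> *\<^sub>R (a *\<^sub>R w1 + b *\<^sub>R w2)"
      using ab by simp
    also have "\<dots> = a *\<^sub>R (y + \<delta> *\<^sub>R w1) + b *\<^sub>R (y + \<delta> *\<^sub>R w2)"
      by (simp add: algebra_simps)
    also have "\<dots> \<in> Y"
      using d ab by (intro convexD[OF Y(2)] shrink[of \<delta> \<delta>1] shrink[of \<delta> \<delta>2]) (auto simp: \<delta>_def)
    finally show "a *\<^sub>R w1 + b *\<^sub>R w2 \<in> S"
      using d by (auto simp: S_def \<delta>_def intro!: exI[of _ "min \<delta>1 \<delta>2"])
  qed
  have "0 \<in> S"
    using y by (auto simp: S_def intro: exI[of _ 1])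
  have clS: "closed (closure S)" "convex (closure S)" "closure S \<noteq> {}"
    using \<open>convex S\<close> \<open>0 \<in> S\<close> by (auto simp: convex_closure)
  define d where "d = closest_point (closure S) v"
  have "d \<in> closure S"
    using clS by (auto simp: d_def closest_point_in_set)
  \<comment> \<open>A fixed \<open>w\<close> close to \<open>d\<close> serves all steps up to its
    own \<delta>0, so no rate of convergence is involved.\<close>
  have near: "norm (q \<delta> - d) < e" if "e > 0" "\<delta> > 0" "\<delta> \<le> \<delta>0" "y + \<delta>0 *\<^sub>R w \<in> Y"
      "2 * norm (v - d) * norm (w - d) + (norm (w - d))\<^sup>2 < e\<^sup>2" for e \<delta> \<delta>0 w
  proof -
    have "Y \<noteq> {}"
      using y by blast
    have "y + \<delta> *\<^sub>R q \<delta> = closest_point Y (y + \<delta> *\<^sub>R v)"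
      using that by (simp add: q_def)
    also have "\<dots> \<in> Y"
      using Y y by (metis closest_point_in_set empty_iff)
    finally have "q \<delta> \<in> S"
      using that by (auto simp: S_def)
    then have "(v - d) \<bullet> (q \<delta> - d) \<le> 0"
      unfolding d_def using clS closure_subset by (intro closest_point_dot) auto
    moreover have "(v - q \<delta>) \<bullet> (w - q \<delta>) \<le> 0"
      unfolding q_def
      using that shrink[of \<delta> \<delta>0 w] \<open>Y \<noteq> {}\<close> by (intro closest_point_scaled_translate Y) auto
    ultimately have "(norm (q \<delta> - d))\<^sup>2 < e\<^sup>2"
      using norm_obtuse_diff_le[of v d "q \<delta>" w] that(5) by linarith
    then show ?thesis
      using \<open>e > 0\<close> by (simp add: power_less_imp_less_base)
  qed
  have "(q \<longlongrightarrow> d) (at_right 0)"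
  proof (rule tendstoI)
    fix e :: real assume "e > 0"
    have "((\<lambda>r. 2 * norm (v - d) * r + r\<^sup>2) \<longlongrightarrow> 2 * norm (v - d) * 0 + 0\<^sup>2) (at_right 0)"
      by (intro tendsto_intros)
    then have "\<forall>\<^sub>F r in at_right 0. 2 * norm (v - d) * r + r\<^sup>2 < e\<^sup>2"
      using \<open>e > 0\<close> by (intro order_tendstoD) auto
    then obtain r where r: "r > 0" "\<And>s. 0 < s \<Longrightarrow> s < r \<Longrightarrow> 2 * norm (v - d) * s + s\<^sup>2 < e\<^sup>2"
      unfolding eventually_at_right_field by auto
    obtain w where "w \<in> S" and w: "norm (w - d) < r"
      using \<open>d \<in> closure S\<close> \<open>r > 0\<close> by (metis closure_approachable dist_norm)
    then obtain \<delta>0 where "\<delta>0 > 0" "y + \<delta>0 *\<^sub>R w \<in> Y"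
      by (auto simp: S_def)
    \<comment> \<open>The choice of \<open>r\<close> covers only positive arguments, hence the
      separate case \<open>w = d\<close>.\<close>
    have "2 * norm (v - d) * norm (w - d) + (norm (w - d))\<^sup>2 < e\<^sup>2"
      using r(2)[of "norm (w - d)"] w \<open>e > 0\<close> by (cases "w = d") auto
    then have "dist (q \<delta>) d < e" if "0 < \<delta>" "\<delta> < \<delta>0" for \<delta>
      using near[OF \<open>e > 0\<close> that(1) _ \<open>y + \<delta>0 *\<^sub>R w \<in> Y\<close>] that by (simp add: dist_norm)
    then show "\<forall>\<^sub>F \<delta> in at_right 0. dist (q \<delta>) d < e"
      using \<open>\<delta>0 > 0\<close> unfolding eventually_at_right_field by blast
  qed
  moreover have "projected_dir Y y v = d"
    unfolding projected_dir_def q_def[symmetric]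
    using \<open>(q \<longlongrightarrow> d) (at_right 0)\<close> by (intro tendsto_Lim) auto
  ultimately show ?thesis
    by (simp add: q_def[abs_def])
qed

lemma inner_projected_dir_le:
  fixes Y :: "'a::euclidean_space set"
  assumes Y: "closed Y" "convex Y" and y: "y \<in> Y" and z: "z \<in> Y"
  shows "(y - z) \<bullet> projected_dir Y y v \<le> (y - z) \<bullet> v"
proof -
  define q where "q \<delta> = (closest_point Y (y + \<delta> *\<^sub>R v) - y) /\<^sub>R \<delta>" for \<delta> :: real
  have q: "(q \<longlongrightarrow> projected_dir Y y v) (at_right 0)"
    using projected_dir_tendsto[OF Y y] by (simp add: q_def[abs_def])
  \<comment> \<open>The obtuse-angle inequality is tested with
    \<open>(z - y) /\<^sub>R \<delta>\<close> and multiplied by \<delta>; the term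
    \<open>\<delta> *\<^sub>R q \<delta>\<close> vanishes in the limit.\<close>
  have "((\<lambda>\<delta>. (v - q \<delta>) \<bullet> (z - y - \<delta> *\<^sub>R q \<delta>)) \<longlongrightarrow>
      (v - projected_dir Y y v) \<bullet> (z - y - 0 *\<^sub>R projected_dir Y y v)) (at_right 0)"
    by (intro tendsto_intros q)
  moreover have "(v - q \<delta>) \<bullet> (z - y - \<delta> *\<^sub>R q \<delta>) \<le> 0" if "\<delta> > 0" for \<delta>
  proof -
    have "(v - q \<delta>) \<bullet> ((z - y) /\<^sub>R \<delta> - q \<delta>) \<le> 0"
      unfolding q_def using that z by (intro closest_point_scaled_translate Y) auto
    moreover have "z - y - \<delta> *\<^sub>R q \<delta> = \<delta> *\<^sub>R ((z - y) /\<^sub>R \<delta> - q \<delta>)"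
      using that by (simp add: algebra_simps)
    ultimately show ?thesis
      using that by (simp add: mult_le_0_iff)
  qed
  then have "\<forall>\<^sub>F \<delta> in at_right 0. (v - q \<delta>) \<bullet> (z - y - \<delta> *\<^sub>R q \<delta>) \<le> 0"
    by (simp add: eventually_at_right_less eventually_at_filter)
  ultimately have "(v - projected_dir Y y v) \<bullet> (z - y) \<le> 0"
    by (auto dest: tendsto_upperbound)
  then show ?thesis
    by (simp add: inner_diff_left inner_diff_right inner_commute)
qed

subsection \<open>Convex integrands\<close>

text \<open>The finite set \<open>B\<close> is an affine basis of the hull of \<open>X\<close>: a convex function on \<open>X\<close> is bounded by
  its values at the points of \<open>B\<close> on a relative neighbourhood of \<open>c\<close>, although it may be unbounded
  on \<open>X\<close>.\<close>
lemma finite_hull_neighbourhood: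
  fixes X :: "'a::euclidean_space set"
  assumes "convex X" "X \<noteq> {}"
  obtains B c e where "finite B" "B \<subseteq> X" "c \<in> X" "e > 0"
    and "\<And>u v r. u \<in> X \<Longrightarrow> v \<in> X \<Longrightarrow> norm (r *\<^sub>R (u - v)) < e \<Longrightarrow> c + r *\<^sub>R (u - v) \<in> convex hull B"
proof -
  obtain B where B: "B \<subseteq> X" "\<not> affine_dependent B" "affine hull X = affine hull B"
    using affine_basis_exists by metis
  have "B \<noteq> {}"
    using B(3) assms(2) by (metis affine_hull_eq_empty)
  then have "rel_interior (convex hull B) \<noteq> {}"
    by (simp add: rel_interior_eq_empty)
  then obtain c e where c: "c \<in> convex hull B" and "e > 0"
    and e: "ball c e \<inter> affine hull (convex hull B) \<subseteq> convex hull B"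
    using mem_rel_interior_ball by (metis ex_in_conv)
  have "convex hull B \<subseteq> X"
    using B(1) assms(1) by (rule hull_minimal)
  show thesis
  proof
    show "finite B"
      using B(2) aff_independent_finite by blast
    show "c \<in> X"
      using c \<open>convex hull B \<subseteq> X\<close> by blast
    fix u v r assume "u \<in> X" "v \<in> X" and small: "norm (r *\<^sub>R (u - v)) < e"
    have "c + r *\<^sub>R (u - v) \<in> affine hull X"
    proof (rule mem_affine_3_minus[OF affine_affine_hull])
      show "c \<in> affine hull X" "u \<in> affine hull X" "v \<in> affine hull X"
        using \<open>u \<in> X\<close> \<open>v \<in> X\<close> \<open>c \<in> X\<close> by (auto intro: hull_inc)
    qed
    moreover have "c + r *\<^sub>R (u - v) \<in> ball c e"
      using small by (simp add: dist_norm)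
    ultimately show "c + r *\<^sub>R (u - v) \<in> convex hull B"
      using e B(3) by (auto simp: affine_hull_convex_hull)
  qed (use B \<open>e > 0\<close> in auto)
qed

text \<open>The maximum principle on a polytope. The sum of absolute values dominates the values at
  the generating points and stays absolutely integrable when \<open>g\<close> depends on
  time.\<close>

lemma convex_on_hull_le_sum:
  assumes "convex_on X g" "convex X" "finite B" "B \<subseteq> X" "z \<in> convex hull B"
  shows "g z \<le> (\<Sum>b\<in>B. \<bar>g b\<bar>)"
proof -
  have "convex hull B \<subseteq> X"
    using assms by (intro hull_minimal) auto
  then have "convex_on (convex hull B) g"
    using assms(1) convex_on_subset by (metis convex_convex_hull)
  moreover have "\<forall>b\<in>B. g b \<le> (\<Sum>b\<in>B. \<bar>g b\<bar>)"
    using assms(3) member_le_sum[of _ B "\<lambda>b. \<bar>g b\<bar>"] by (fastforce intro: order_trans[OF abs_ge_self])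
  ultimately show ?thesis
    using assms(5) convex_on_convex_hull_bound by blast
qed

text \<open>The point \<open>c\<close> lies on the segment from \<open>z\<close> to a point
  \<open>w\<close> slightly beyond \<open>c\<close>. Convexity bounds \<open>g t c\<close> by
  \<open>g t z\<close> and \<open>g t w\<close>, and the values on \<open>B\<close> control
  \<open>g t w\<close>; solving for \<open>g t z\<close> gives a minorant uniform in
  \<open>z\<close>.\<close>

lemma convex_integrand_lower_bound:
  fixes g :: "real \<Rightarrow> 'a::euclidean_space \<Rightarrow> real"
  assumes X: "compact X" "convex X"
    and cvx: "\<And>t. t \<in> J \<Longrightarrow> convex_on X (g t)"
    and int: "\<And>z. z \<in> X \<Longrightarrow> (\<lambda>t. g t z) absolutely_integrable_on J"
  obtains b where "b absolutely_integrable_on J" "\<And>t z. t \<in> J \<Longrightarrow> z \<in> X \<Longrightarrow> b t \<le> g t z"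
proof (cases "X = {}")
  case True
  then show thesis
    using that[of "\<lambda>_. 0"] by simp
next
  case False
  obtain B c e where B: "finite B" "B \<subseteq> X" and c: "c \<in> X" and "e > 0"
    and hull: "\<And>u v r. u \<in> X \<Longrightarrow> v \<in> X \<Longrightarrow> norm (r *\<^sub>R (u - v)) < e \<Longrightarrow> c + r *\<^sub>R (u - v) \<in> convex hull B"
    using finite_hull_neighbourhood[OF X(2) False] by metis
  obtain D where "D > 0" and D: "\<And>z. z \<in> X \<Longrightarrow> norm (c - z) < D"
  proof -
    obtain D where D: "\<forall>x\<in>X. \<forall>y\<in>X. dist x y \<le> D"
      using compact_imp_bounded[OF X(1)] by (meson bounded_two_points)
    show thesis
      using D c by (intro that[of "\<bar>D\<bar> + 1"]) (fastforce simp: dist_norm)+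
  qed
  \<comment> \<open>With this ratio \<open>r *\<^sub>R (c - z)\<close> is shorter than
    \<open>e\<close> for every \<open>z\<close> in \<open>X\<close>.\<close>
  define r where "r = e / D"
  have "r > 0"
    using \<open>e > 0\<close> \<open>D > 0\<close> by (simp add: r_def)
  define b where "b t = ((1 + r) * g t c - (\<Sum>b\<in>B. \<bar>g t b\<bar>)) / r" for t
  show thesis
  proof
    have "(\<lambda>t. \<Sum>b\<in>B. \<bar>g t b\<bar>) absolutely_integrable_on J"
      using B by (intro absolutely_integrable_sum set_integrable_abs int) auto
    then have "(\<lambda>t. (1 / r) * ((1 + r) * g t c - (\<Sum>b\<in>B. \<bar>g t b\<bar>))) absolutely_integrable_on J"
      using int[OF c] by (intro set_integrable_mult_right set_integral_diff(1)) auto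
    then show "b absolutely_integrable_on J"
      by (simp add: b_def[abs_def])
    fix t z assume "t \<in> J" "z \<in> X"
    define w where "w = c + r *\<^sub>R (c - z)"
    have "norm (r *\<^sub>R (c - z)) < e"
      using mult_strict_left_mono[OF D[OF \<open>z \<in> X\<close>] \<open>r > 0\<close>] \<open>e > 0\<close> \<open>D > 0\<close> by (simp add: r_def)
    then have w: "w \<in> convex hull B"
      unfolding w_def by (intro hull c \<open>z \<in> X\<close>)
    then have "w \<in> X"
      using B(2) X(2) by (metis hull_minimal subsetD)
    have "c = (r / (1 + r)) *\<^sub>R z + (1 / (1 + r)) *\<^sub>R w"
    proof -
      have "(1 + r) *\<^sub>R c = (1 + r) *\<^sub>R ((r / (1 + r)) *\<^sub>R z + (1 / (1 + r)) *\<^sub>R w)"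
        using \<open>r > 0\<close> by (simp add: scaleR_add_right w_def) (simp add: algebra_simps)
      then show ?thesis
        using \<open>r > 0\<close> by (simp only: scaleR_cancel_left) auto
    qed
    moreover have "g t (\<alpha> *\<^sub>R z + \<beta> *\<^sub>R w) \<le> \<alpha> * g t z + \<beta> * g t w"
      if "\<alpha> \<ge> 0" "\<beta> \<ge> 0" "\<alpha> + \<beta> = 1" for \<alpha> \<beta>
      using cvx[OF \<open>t \<in> J\<close>] \<open>z \<in> X\<close> \<open>w \<in> X\<close> that unfolding convex_on_def by blast
    from this[of "r / (1 + r)" "1 / (1 + r)"]
    have "g t ((r / (1 + r)) *\<^sub>R z + (1 / (1 + r)) *\<^sub>R w)
        \<le> (r / (1 + r)) * g t z + (1 / (1 + r)) * g t w"
      using \<open>r > 0\<close> by (simp add: add_divide_distrib[symmetric] add.commute)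
    ultimately have "g t c \<le> (r * g t z + g t w) / (1 + r)"
      by (simp add: add_divide_distrib)
    then have "(1 + r) * g t c \<le> r * g t z + g t w"
      using \<open>r > 0\<close> by (simp add: pos_le_divide_eq mult.commute)
    also have "g t w \<le> (\<Sum>b\<in>B. \<bar>g t b\<bar>)"
      using cvx[OF \<open>t \<in> J\<close>] X(2) B w by (rule convex_on_hull_le_sum)
    finally show "b t \<le> g t z"
      using \<open>r > 0\<close> by (simp add: b_def field_simps)
  qed
qed

text \<open>The function \<open>g t\<close> need not be continuous on \<open>X\<close>. The step functions \<open>y k\<close> below are pulled
  towards the relative interior point \<open>c\<close>, by \<open>1 / (k + 2)\<close>, which is large compared to their distance
  from \<open>x\<close>; so convexity bounds \<open>g t (y k t)\<close> from above, and the subgradient at \<open>x t\<close> from below.\<close>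
lemma convex_integrand_measurable:
  fixes g :: "real \<Rightarrow> 'a::euclidean_space \<Rightarrow> real"
  assumes X: "compact X" "convex X" and "T \<ge> 0"
    and cvx: "\<And>t. t \<in> {0..T} \<Longrightarrow> convex_on X (g t)"
    and sub: "\<And>t z. t \<in> {0..T} \<Longrightarrow> z \<in> X \<Longrightarrow> is_subgradient X (g t) z (gx t z)"
    and meas: "\<And>z. z \<in> X \<Longrightarrow> (\<lambda>t. g t z) \<in> borel_measurable (lebesgue_on {0..T})"
    and x: "continuous_on {0..T} x" "x \<in> {0..T} \<rightarrow> X"
  shows "(\<lambda>t. g t (x t)) \<in> borel_measurable (lebesgue_on {0..T})"
proof -
  have "X \<noteq> {}"
    using x(2) \<open>T \<ge> 0\<close> by fastforce
  obtain B c e where B: "finite B" "B \<subseteq> X" and c: "c \<in> X" and "e > 0"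
    and hull: "\<And>u v r. u \<in> X \<Longrightarrow> v \<in> X \<Longrightarrow> norm (r *\<^sub>R (u - v)) < e \<Longrightarrow> c + r *\<^sub>R (u - v) \<in> convex hull B"
    using finite_hull_neighbourhood[OF X(2) \<open>X \<noteq> {}\<close>] by metis
  \<comment> \<open>The summand 2 gives \<open>s k < 1\<close> already at
    \<open>k = 0\<close>.\<close>
  define s where "s k = 1 / (real k + 2)" for k
  have s: "0 < s k" "s k < 1" for k
    by (auto simp: s_def)
  have "s \<longlonglongrightarrow> 0"
    using LIMSEQ_ignore_initial_segment[OF lim_1_over_n[where 'a = real], of 2]
    by (simp add: s_def[abs_def] add.commute)
  have "\<exists>d>0. \<forall>t\<in>{0..T}. \<forall>t'\<in>{0..T}. dist t' t < d \<longrightarrow> dist (x t') (x t) < e * s k" for k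
    using compact_uniformly_continuous[OF x(1)] \<open>e > 0\<close> s[of k]
    unfolding uniformly_continuous_on_def by simp
  then obtain d where d: "\<And>k. d k > 0"
    and xd: "\<And>k t t'. t \<in> {0..T} \<Longrightarrow> t' \<in> {0..T} \<Longrightarrow> dist t' t < d k \<Longrightarrow> dist (x t') (x t) < e * s k"
    by metis
  \<comment> \<open>Grid points of mesh \<open>d k / 2\<close>, clamped to the interval on which
    \<open>x\<close> takes values in \<open>X\<close>.\<close>
  define grid where "grid k i = max 0 (min T (of_int i * (d k / 2)))" for k and i :: int
  have grid: "grid k i \<in> {0..T}" for k i
    using \<open>T \<ge> 0\<close> by (auto simp: grid_def)
  define u where "u k i = (1 - s k) *\<^sub>R x (grid k i) + s k *\<^sub>R c" for k i
  have u: "u k i \<in> X" for k i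
    unfolding u_def using x(2) grid[of k i] c s[of k] by (intro convexD[OF X(2)]) auto
  \<comment> \<open>For each \<open>k\<close> only countably many values occur, so measurability in
    time at fixed points of \<open>X\<close> suffices.\<close>
  define y where "y k t = u k \<lfloor>t / (d k / 2)\<rfloor>" for k t
  show ?thesis
  proof (rule borel_measurable_LIMSEQ_real)
    show "(\<lambda>t. g t (y k t)) \<in> borel_measurable (lebesgue_on {0..T})" for k
      unfolding y_def
    proof (rule measurable_compose_countable[where f = "\<lambda>i t. g t (u k i)"])
      show "(\<lambda>t. g t (u k i)) \<in> borel_measurable (lebesgue_on {0..T})" for i
        by (rule meas[OF u])
      have "(\<lambda>t. \<lfloor>t / (d k / 2)\<rfloor>) \<in> measurable borel (count_space UNIV)"
        by measurable
      then show "(\<lambda>t. \<lfloor>t / (d k / 2)\<rfloor>) \<in> measurable (lebesgue_on {0..T}) (count_space UNIV)"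
        by (intro measurable_restrict_space1 measurable_completion) auto
    qed
    fix t assume "t \<in> space (lebesgue_on {0..T})"
    then have t: "t \<in> {0..T}"
      by simp
    then have xt: "x t \<in> X"
      using x(2) by blast
    define M where "M = (\<Sum>b\<in>B. \<bar>g t b\<bar>)"
    define x' where "x' k = x (grid k \<lfloor>t / (d k / 2)\<rfloor>)" for k
    have x': "norm (x' k - x t) < e * s k" for k
    proof -
      have "of_int \<lfloor>t / (d k / 2)\<rfloor> * (d k / 2) \<le> t" "t < (of_int \<lfloor>t / (d k / 2)\<rfloor> + 1) * (d k / 2)"
        using d[of k] by (intro floor_divide_lower floor_divide_upper; simp)+
      then have "dist (grid k \<lfloor>t / (d k / 2)\<rfloor>) t < d k"
        using t d[of k] unfolding grid_def dist_real_def distrib_right by auto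
      then show ?thesis
        unfolding x'_def dist_norm[symmetric] by (intro xd t grid)
    qed
    have y: "y k t = (1 - s k) *\<^sub>R x' k + s k *\<^sub>R c" for k
      by (simp add: y_def u_def x'_def)
    have x'X: "x' k \<in> X" for k
      unfolding x'_def using x(2) grid by blast
    have upper: "g t (y k t) \<le> (1 - s k) * g t (x t) + s k * M" for k
    proof -
      \<comment> \<open>The point that makes \<open>y k t\<close> a convex combination of
        \<open>x t\<close> and \<open>w\<close>. The factor \<open>s k\<close> in the modulus
        \<open>e * s k\<close> cancels the division by \<open>s k\<close> and keeps \<open>w\<close>
        in the hull of \<open>B\<close>.\<close>
      define w where "w = c + ((1 - s k) / s k) *\<^sub>R (x' k - x t)"
      have "(1 - s k) * norm (x' k - x t) \<le> 1 * norm (x' k - x t)"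
        using s[of k] by (intro mult_right_mono) auto
      then have "(1 - s k) * norm (x' k - x t) < e * s k"
        using x'[of k] by simp
      then have "norm (((1 - s k) / s k) *\<^sub>R (x' k - x t)) < e"
        using s[of k] by (simp add: pos_divide_less_eq)
      then have w: "w \<in> convex hull B"
        unfolding w_def by (intro hull xt x'X)
      then have "w \<in> X"
        using B(2) X(2) by (metis hull_minimal subsetD)
      have "s k *\<^sub>R w = s k *\<^sub>R c + (1 - s k) *\<^sub>R (x' k - x t)"
        using s[of k] by (simp add: w_def scaleR_add_right)
      then have "y k t = (1 - s k) *\<^sub>R x t + s k *\<^sub>R w"
        unfolding y by (simp add: algebra_simps)
      also have "g t \<dots> \<le> (1 - s k) * g t (x t) + s k * g t w"
        using cvx[OF t] xt \<open>w \<in> X\<close> s[of k] unfolding convex_on_def by auto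
      also have "\<dots> \<le> (1 - s k) * g t (x t) + s k * M"
        using convex_on_hull_le_sum[OF cvx[OF t] X(2) B w] s[of k] by (simp add: M_def)
      finally show ?thesis .
    qed
    have lower: "g t (x t) + gx t (x t) \<bullet> (y k t - x t) \<le> g t (y k t)" for k
      using sub[OF t xt] u unfolding is_subgradient_def y_def by blast
    have "(\<lambda>k. x' k - x t) \<longlonglongrightarrow> 0"
    proof (rule Lim_null_comparison)
      show "\<forall>\<^sub>F k in sequentially. norm (x' k - x t) \<le> e * s k"
        using x' by (intro always_eventually) (auto intro: less_imp_le)
      show "(\<lambda>k. e * s k) \<longlonglongrightarrow> 0"
        using tendsto_mult_right_zero[OF \<open>s \<longlonglongrightarrow> 0\<close>] .
    qed
    then have "x' \<longlonglongrightarrow> x t"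
      by (simp add: LIM_zero_iff)
    then have "(\<lambda>k. y k t) \<longlonglongrightarrow> (1 - 0) *\<^sub>R x t + 0 *\<^sub>R c"
      unfolding y by (intro tendsto_intros \<open>s \<longlonglongrightarrow> 0\<close>)
    then have "(\<lambda>k. g t (x t) + gx t (x t) \<bullet> (y k t - x t)) \<longlonglongrightarrow> g t (x t) + gx t (x t) \<bullet> (x t - x t)"
      by (intro tendsto_intros) simp
    then have lim1: "(\<lambda>k. g t (x t) + gx t (x t) \<bullet> (y k t - x t)) \<longlonglongrightarrow> g t (x t)"
      by simp
    have "(\<lambda>k. (1 - s k) * g t (x t) + s k * M) \<longlonglongrightarrow> (1 - 0) * g t (x t) + 0 * M"
      by (intro tendsto_intros \<open>s \<longlonglongrightarrow> 0\<close>)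
    then have lim2: "(\<lambda>k. (1 - s k) * g t (x t) + s k * M) \<longlonglongrightarrow> g t (x t)"
      by simp
    show "(\<lambda>k. g t (y k t)) \<longlonglongrightarrow> g t (x t)"
      by (rule tendsto_sandwich[OF _ _ lim1 lim2]) (auto intro: always_eventually lower upper)
  qed
qed

lemma absolutely_integrable_sandwich:
  fixes F :: "real \<Rightarrow> real"
  assumes F: "F \<in> borel_measurable (lebesgue_on S)" "S \<in> sets lebesgue"
    and b: "b absolutely_integrable_on S" and c: "c absolutely_integrable_on S"
    and le: "\<And>t. t \<in> S \<Longrightarrow> b t \<le> F t" "\<And>t. t \<in> S \<Longrightarrow> F t \<le> c t"
  shows "F absolutely_integrable_on S"
proof (rule measurable_bounded_by_integrable_imp_absolutely_integrable[OF F])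
  have "(\<lambda>t. \<bar>b t\<bar> + \<bar>c t\<bar>) absolutely_integrable_on S"
    by (intro set_integral_add set_integrable_abs b c)
  then show "(\<lambda>t. \<bar>b t\<bar> + \<bar>c t\<bar>) integrable_on S"
    using set_lebesgue_integral_eq_integral(1) by blast
  show "norm (F t) \<le> \<bar>b t\<bar> + \<bar>c t\<bar>" if "t \<in> S" for t
    using le[OF that] by auto
qed

subsection \<open>The saddle point controller\<close>

lemma nonneg_orthant_closed_convex:
  "closed (nonneg_orthant :: (real ^ 'm) set)" "convex (nonneg_orthant :: (real ^ 'm) set)"
proof -
  show "closed (nonneg_orthant :: (real ^ 'm) set)"
    unfolding nonneg_orthant_def by (intro closed_Collect_all closed_Collect_le continuous_intros)
  show "convex (nonneg_orthant :: (real ^ 'm) set)"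
    by (rule convexI) (simp add: nonneg_orthant_def)
qed

locale saddle_point_trajectory =
  fixes X :: "(real ^ 'n) set"
    and f :: "real \<Rightarrow> real ^ 'n \<Rightarrow> real ^ 'm"
    and fx :: "real \<Rightarrow> real ^ 'n \<Rightarrow> real ^ 'm ^ 'n"
    and f0 :: "real \<Rightarrow> real ^ 'n \<Rightarrow> real"
    and f0x :: "real \<Rightarrow> real ^ 'n \<Rightarrow> real ^ 'n"
    and \<epsilon> :: real and x :: "real \<Rightarrow> real ^ 'n" and l :: "real \<Rightarrow> real ^ 'm"
  assumes X: "compact X" "convex X"
    and f_int: "\<And>T z. T > 0 \<Longrightarrow> z \<in> X \<Longrightarrow> (\<lambda>t. f t z) absolutely_integrable_on {0..T}"
    and f_cvx: "\<And>t i. t \<ge> 0 \<Longrightarrow> convex_on X (\<lambda>z. f t z $ i)"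
    and f_sub: "\<And>t z i. t \<ge> 0 \<Longrightarrow> z \<in> X \<Longrightarrow> is_subgradient X (\<lambda>z. f t z $ i) z (column i (fx t z))"
    and f0_int: "\<And>T z. T > 0 \<Longrightarrow> z \<in> X \<Longrightarrow> (\<lambda>t. f0 t z) absolutely_integrable_on {0..T}"
    and f0_cvx: "\<And>t. t \<ge> 0 \<Longrightarrow> convex_on X (f0 t)"
    and f0_sub: "\<And>t z. t \<ge> 0 \<Longrightarrow> z \<in> X \<Longrightarrow> is_subgradient X (f0 t) z (f0x t z)"
    and \<epsilon>: "\<epsilon> > 0"
    and sol: "saddle_point_solution X f f0x fx \<epsilon> x l"
begin

definition xdot :: "real \<Rightarrow> real ^ 'n" where
  "xdot t = projected_dir X (x t) (- (\<epsilon> *\<^sub>R (f0x t (x t) + fx t (x t) *v l t)))"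

definition ldot :: "real \<Rightarrow> real ^ 'm" where
  "ldot t = projected_dir nonneg_orthant (l t) (\<epsilon> *\<^sub>R f t (x t))"

lemma x_in: "t \<ge> 0 \<Longrightarrow> x t \<in> X"
  and l_in: "t \<ge> 0 \<Longrightarrow> l t \<in> nonneg_orthant"
  and l_nonneg: "t \<ge> 0 \<Longrightarrow> 0 \<le> l t $ i"
  and ac_x: "T > 0 \<Longrightarrow> abs_continuous_on_interval 0 T x"
  and ac_l: "T > 0 \<Longrightarrow> abs_continuous_on_interval 0 T l"
  using sol by (auto simp: saddle_point_solution_def nonneg_orthant_def)

lemma derivatives_ae:
  obtains N where "negligible N"
    "\<And>t. t \<ge> 0 \<Longrightarrow> t \<notin> N \<Longrightarrow> (x has_vector_derivative xdot t) (at t)"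
    "\<And>t. t \<ge> 0 \<Longrightarrow> t \<notin> N \<Longrightarrow> (l has_vector_derivative ldot t) (at t)"
proof -
  have "AE t in lborel. t > 0 \<longrightarrow> (x has_vector_derivative xdot t) (at t) \<and>
      (l has_vector_derivative ldot t) (at t)"
    using sol by (simp add: saddle_point_solution_def xdot_def ldot_def)
  then obtain N where N: "N \<in> null_sets lborel"
    "{t \<in> space lborel. \<not> (t > 0 \<longrightarrow> (x has_vector_derivative xdot t) (at t) \<and>
      (l has_vector_derivative ldot t) (at t))} \<subseteq> N"
    unfolding eventually_ae_filter by blast
  have "negligible N"
    using null_sets_completionI[OF N(1)] negligible_iff_null_sets by blast
  \<comment> \<open>The equations are imposed only at positive times, so 0 joins the exceptional
    set.\<close>
  then have "negligible (insert 0 N)"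
    by simp
  moreover have "(x has_vector_derivative xdot t) (at t) \<and> (l has_vector_derivative ldot t) (at t)"
    if "t \<ge> 0" "t \<notin> insert 0 N" for t
  proof -
    have "t > 0"
      using that by auto
    then show ?thesis
      using N(2) that(2) by auto
  qed
  ultimately show thesis
    using that by blast
qed

text \<open>The projection inequality removes the projection, and subgradient inequalities turn the
  remaining inner products into differences of function values. Those of the constraints are
  weighted by the multipliers, whose sign preserves them.\<close>

lemma inner_xdot_le:
  assumes "t \<ge> 0" "z \<in> X"
  shows "(x t - z) \<bullet> xdot t \<le> \<epsilon> * (f0 t z - f0 t (x t) + l t \<bullet> (f t z - f t (x t)))"
proof -
  have xt: "x t \<in> X"
    by (rule x_in[OF assms(1)])
  have "(x t - z) \<bullet> xdot t \<le> (x t - z) \<bullet> (- (\<epsilon> *\<^sub>R (f0x t (x t) + fx t (x t) *v l t)))"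
    unfolding xdot_def using X xt assms(2)
    by (intro inner_projected_dir_le) (auto simp: compact_imp_closed)
  also have "\<dots> = \<epsilon> * (f0x t (x t) \<bullet> (z - x t) + (fx t (x t) *v l t) \<bullet> (z - x t))"
    by (simp add: inner_diff_left inner_diff_right inner_add_left inner_add_right inner_commute algebra_simps)
  also have "\<dots> \<le> \<epsilon> * (f0 t z - f0 t (x t) + l t \<bullet> (f t z - f t (x t)))"
  proof -
    have "f0x t (x t) \<bullet> (z - x t) \<le> f0 t z - f0 t (x t)"
      using f0_sub[OF assms(1) xt] assms(2) by (auto simp: is_subgradient_def algebra_simps)
    moreover have "(fx t (x t) *v l t) \<bullet> (z - x t) = (\<Sum>i\<in>UNIV. l t $ i * (column i (fx t (x t)) \<bullet> (z - x t)))"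
      by (simp add: matrix_mult_sum inner_sum_left scalar_mult_eq_scaleR)
    moreover have "\<dots> \<le> (\<Sum>i\<in>UNIV. l t $ i * (f t z $ i - f t (x t) $ i))"
    proof (intro sum_mono mult_left_mono l_nonneg assms(1))
      fix i
      show "column i (fx t (x t)) \<bullet> (z - x t) \<le> f t z $ i - f t (x t) $ i"
        using f_sub[OF assms(1) xt, of i] assms(2) by (auto simp: is_subgradient_def algebra_simps)
    qed
    moreover have "\<dots> = l t \<bullet> (f t z - f t (x t))"
      by (simp add: inner_vec_def)
    ultimately show ?thesis
      using \<epsilon> by (intro mult_left_mono) auto
  qed
  finally show ?thesis .
qed

lemma inner_ldot_le:
  assumes "t \<ge> 0" "\<mu> \<in> nonneg_orthant"
  shows "(l t - \<mu>) \<bullet> ldot t \<le> \<epsilon> * ((l t - \<mu>) \<bullet> f t (x t))"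
  using inner_projected_dir_le[OF nonneg_orthant_closed_convex l_in[OF assms(1)] assms(2)]
  unfolding ldot_def by (metis inner_scaleR_right)

text \<open>Test the variational inequality for the multiplier with \<open>l t\<close> moved up along the axis \<open>i\<close>.\<close>
lemma constraint_le_ldot:
  assumes "t \<ge> 0"
  shows "\<epsilon> * f t (x t) $ i \<le> ldot t $ i"
proof -
  have "l t + axis i 1 \<in> nonneg_orthant"
    using l_nonneg[OF assms] by (auto simp: nonneg_orthant_def axis_def intro: add_nonneg_nonneg)
  from inner_ldot_le[OF assms this] show ?thesis
    by (simp add: inner_axis' inner_commute)
qed

section \<open>Integrability along the trajectory, and the fit\<close>

lemma multiplier_derivative_absolutely_integrable:
  assumes "T > 0" and b: "b absolutely_integrable_on {0..T}" "\<And>t. t \<in> {0..T} \<Longrightarrow> b t \<le> f t (x t) $ i"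
  shows "(\<lambda>t. ldot t $ i) absolutely_integrable_on {0..T}"
proof -
  obtain N where N: "negligible N"
    "\<And>t. t \<ge> 0 \<Longrightarrow> t \<notin> N \<Longrightarrow> (l has_vector_derivative ldot t) (at t)"
    using derivatives_ae by metis
  \<comment> \<open>The constraint bounds \<open>ldot\<close> from below; the change of sign turns
    this into the required upper bound.\<close>
  have "(\<lambda>t. - (ldot t $ i)) absolutely_integrable_on {0..T}"
  proof (rule abs_continuous_derivative_absolutely_integrable[where g = "\<lambda>t. - (l t $ i)", OF _ _ N(1)])
    show "abs_continuous_on_interval 0 T (\<lambda>t. - (l t $ i))"
      by (rule abs_continuous_on_interval_compose_lipschitz[OF ac_l[OF assms(1)], of 1])
        (auto simp: component_le_norm_cart[of "_ - _", simplified] abs_minus_commute)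
    fix t assume t: "t \<in> {0..T} - N"
    then have "(l has_vector_derivative ldot t) (at t)"
      using N by simp
    then show "((\<lambda>t. - (l t $ i)) has_vector_derivative - (ldot t $ i)) (at t)"
      by (intro has_vector_derivative_minus bounded_linear.has_vector_derivative[OF bounded_linear_vec_nth])
    have "\<epsilon> * b t \<le> \<epsilon> * f t (x t) $ i"
      using b(2) t \<epsilon> by simp
    also have "\<dots> \<le> ldot t $ i"
      using constraint_le_ldot t by simp
    finally show "- (ldot t $ i) \<le> - \<epsilon> * b t"
      by simp
  next
    show "(\<lambda>t. - \<epsilon> * b t) absolutely_integrable_on {0..T}"
      by (rule set_integrable_mult_right[OF b(1)])
  qed (use assms in auto)
  from set_integrable_mult_right[OF this, of "- 1"] show ?thesis
    by simp
qed

lemma constraint_absolutely_integrable: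
  assumes "T > 0"
  shows "(\<lambda>t. f t (x t)) absolutely_integrable_on {0..T}"
proof (rule absolutely_integrable_componentwise)
  fix j :: "real ^ 'm" assume "j \<in> Basis"
  then obtain i where j: "j = axis i 1"
    by (auto simp: Basis_vec_def)
  have int: "(\<lambda>t. f t z $ i) absolutely_integrable_on {0..T}" if "z \<in> X" for z
    using absolutely_integrable_component[OF f_int[OF assms that], of j] by (simp add: j inner_axis)
  obtain b where b: "b absolutely_integrable_on {0..T}"
    "\<And>t z. t \<in> {0..T} \<Longrightarrow> z \<in> X \<Longrightarrow> b t \<le> f t z $ i"
    using convex_integrand_lower_bound[OF X, of "{0..T}" "\<lambda>t z. f t z $ i"] f_cvx int by auto
  have bx: "b t \<le> f t (x t) $ i" if "t \<in> {0..T}" for t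
    using that b(2) x_in by simp
  have "(\<lambda>t. f t (x t) $ i) absolutely_integrable_on {0..T}"
  \<comment> \<open>The lower bound comes from convexity, the upper one from the multiplier
    dynamics.\<close>
  proof (rule absolutely_integrable_sandwich[OF _ _ b(1)])
    show "(\<lambda>t. f t (x t) $ i) \<in> borel_measurable (lebesgue_on {0..T})"
    proof (rule convex_integrand_measurable[OF X, where g = "\<lambda>t z. f t z $ i" and gx = "\<lambda>t z. column i (fx t z)"])
      show "(\<lambda>t. f t z $ i) \<in> borel_measurable (lebesgue_on {0..T})" if "z \<in> X" for z
        using int[OF that] by (simp add: absolutely_integrable_measurable_real)
    qed (use assms f_cvx f_sub x_in abs_continuous_on_interval_imp_continuous_on[OF ac_x] in auto)
    show "(\<lambda>t. (1 / \<epsilon>) * (ldot t $ i)) absolutely_integrable_on {0..T}"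
      by (intro set_integrable_mult_right multiplier_derivative_absolutely_integrable[OF assms b(1) bx])
    show "f t (x t) $ i \<le> (1 / \<epsilon>) * (ldot t $ i)" if "t \<in> {0..T}" for t
      using constraint_le_ldot[of t i] that \<epsilon> by (simp add: field_simps)
  qed (use bx in auto)
  then show "(\<lambda>t. f t (x t) \<bullet> j) absolutely_integrable_on {0..T}"
    by (simp add: j inner_axis)
qed

lemma fit_le:
  assumes "T > 0"
  shows "\<epsilon> * fit f x T $ i \<le> l T $ i - l 0 $ i"
proof -
  obtain N where N: "negligible N"
    "\<And>t. t \<ge> 0 \<Longrightarrow> t \<notin> N \<Longrightarrow> (l has_vector_derivative ldot t) (at t)"
    using derivatives_ae by metis
  have int: "(\<lambda>t. f t (x t)) integrable_on {0..T}"
    using constraint_absolutely_integrable[OF assms] set_lebesgue_integral_eq_integral(1) by blast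
  then have inti: "(\<lambda>t. f t (x t) $ i) integrable_on {0..T}"
    using integrable_linear[OF _ bounded_linear_vec_nth] by (fastforce simp: o_def)
  \<comment> \<open>Negated as well, since increments are estimated through upper bounds of the
    derivative.\<close>
  have "- (l T $ i) - - (l 0 $ i) \<le> integral {0..T} (\<lambda>t. - (\<epsilon> * f t (x t) $ i))"
  proof (rule abs_continuous_increment_le_integral[OF _ _ N(1)])
    show "abs_continuous_on_interval 0 T (\<lambda>t. - (l t $ i))"
      by (rule abs_continuous_on_interval_compose_lipschitz[OF ac_l[OF assms(1)], of 1])
        (auto simp: component_le_norm_cart[of "_ - _", simplified] abs_minus_commute)
    fix t assume t: "t \<in> {0..T} - N"
    then have "(l has_vector_derivative ldot t) (at t)"
      using N by simp
    then show "((\<lambda>t. - (l t $ i)) has_vector_derivative - (ldot t $ i)) (at t)"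
      by (intro has_vector_derivative_minus bounded_linear.has_vector_derivative[OF bounded_linear_vec_nth])
    show "- (ldot t $ i) \<le> - (\<epsilon> * f t (x t) $ i)"
      using constraint_le_ldot t by simp
  next
    show "(\<lambda>t. - (\<epsilon> * f t (x t) $ i)) integrable_on {0..T}"
      by (intro integrable_neg integrable_on_mult_right inti)
  qed (use assms in auto)
  also have "\<dots> = - (\<epsilon> * fit f x T $ i)"
    using integral_component_eq_cart[OF int] by (simp add: fit_def)
  finally show ?thesis by simp
qed

lemma objective_absolutely_integrable:
  assumes "T > 0"
  shows "(\<lambda>t. f0 t (x t)) absolutely_integrable_on {0..T}"
proof -
  obtain N where N: "negligible N"
    "\<And>t. t \<ge> 0 \<Longrightarrow> t \<notin> N \<Longrightarrow> (x has_vector_derivative xdot t) (at t)"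
    using derivatives_ae by metis
  \<comment> \<open>Any point of \<open>X\<close> can serve as the reference; the initial state is
    one at hand.\<close>
  define z where "z = x 0"
  have z: "z \<in> X"
    by (simp add: z_def x_in)
  obtain b where b: "b absolutely_integrable_on {0..T}"
    "\<And>t z. t \<in> {0..T} \<Longrightarrow> z \<in> X \<Longrightarrow> b t \<le> f0 t z"
    using convex_integrand_lower_bound[OF X, of "{0..T}" f0] f0_cvx f0_int[OF assms] by auto
  have contl: "continuous_on {0..T} l"
    by (rule abs_continuous_on_interval_imp_continuous_on[OF ac_l[OF assms]])
  have "(\<lambda>t. l t \<bullet> (f t z - f t (x t))) absolutely_integrable_on {0..T}"
  proof (rule absolutely_integrable_bounded_measurable_product[where h = "(\<bullet>)"])
    show "bilinear ((\<bullet>) :: real ^ 'm \<Rightarrow> _)"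
      using bounded_bilinear_inner bilinear_conv_bounded_bilinear by blast
    show "l \<in> borel_measurable (lebesgue_on {0..T})"
      using contl by (rule continuous_imp_measurable_on_sets_lebesgue) auto
    show "bounded (l ` {0..T})"
      using contl by (intro compact_imp_bounded compact_continuous_image) auto
    show "(\<lambda>t. f t z - f t (x t)) absolutely_integrable_on {0..T}"
      by (intro set_integral_diff f_int constraint_absolutely_integrable assms z)
  qed auto
  then have g: "(\<lambda>t. f0 t z + l t \<bullet> (f t z - f t (x t))) absolutely_integrable_on {0..T}"
    by (intro set_integral_add f0_int assms z)
  \<comment> \<open>First \<open>b\<close> replaces the unknown \<open>f0 t (x t)\<close> in the
    upper bound of this derivative. Once the derivative is absolutely integrable, the same
    inequality solved for \<open>f0 t (x t)\<close> gives the majorant.\<close>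
  have "(\<lambda>t. (x t - z) \<bullet> xdot t) absolutely_integrable_on {0..T}"
  proof (rule abs_continuous_derivative_absolutely_integrable[OF _ _ N(1)])
    show "abs_continuous_on_interval 0 T (\<lambda>t. (norm (x t - z))\<^sup>2 / 2)"
      by (intro abs_continuous_on_interval_half_sq_norm ac_x assms)
    show "(\<lambda>t. \<epsilon> * (f0 t z + l t \<bullet> (f t z - f t (x t)) - b t)) absolutely_integrable_on {0..T}"
      by (intro set_integrable_mult_right set_integral_diff g b(1))
    fix t assume t: "t \<in> {0..T} - N"
    then show "((\<lambda>t. (norm (x t - z))\<^sup>2 / 2) has_vector_derivative (x t - z) \<bullet> xdot t) (at t)"
      using N by (intro has_vector_derivative_half_sq_norm) auto
    have "(x t - z) \<bullet> xdot t \<le> \<epsilon> * (f0 t z - f0 t (x t) + l t \<bullet> (f t z - f t (x t)))"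
      using t by (intro inner_xdot_le z) auto
    also have "\<dots> \<le> \<epsilon> * (f0 t z + l t \<bullet> (f t z - f t (x t)) - b t)"
      using t b(2)[of t "x t"] x_in[of t] \<epsilon> by (intro mult_left_mono) auto
    finally show "(x t - z) \<bullet> xdot t \<le> \<dots>" .
  qed (use assms in auto)
  then have c: "(\<lambda>t. f0 t z + l t \<bullet> (f t z - f t (x t)) - (1 / \<epsilon>) * ((x t - z) \<bullet> xdot t))
      absolutely_integrable_on {0..T}"
    by (intro set_integral_diff set_integrable_mult_right g)
  show ?thesis
  proof (rule absolutely_integrable_sandwich[OF _ _ b(1) c])
    show "(\<lambda>t. f0 t (x t)) \<in> borel_measurable (lebesgue_on {0..T})"
    proof (rule convex_integrand_measurable[OF X, where gx = f0x])
      show "(\<lambda>t. f0 t z) \<in> borel_measurable (lebesgue_on {0..T})" if "z \<in> X" for z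
        using f0_int[OF assms that] by (simp add: absolutely_integrable_measurable_real)
    qed (use assms f0_cvx f0_sub x_in abs_continuous_on_interval_imp_continuous_on[OF ac_x] in auto)
    show "b t \<le> f0 t (x t)" if "t \<in> {0..T}" for t
      using that b(2) x_in by simp
    show "f0 t (x t) \<le> f0 t z + l t \<bullet> (f t z - f t (x t)) - (1 / \<epsilon>) * ((x t - z) \<bullet> xdot t)"
      if "t \<in> {0..T}" for t
      using inner_xdot_le[of t z] that z \<epsilon> by (simp add: field_simps)
  qed auto
qed

text \<open>The terms \<open>l \<bullet> f(x)\<close> from the two variational inequalities cancel.\<close>
lemma energy_increment_le:
  assumes "T > 0" "z \<in> X" and feas: "\<And>t i. t \<in> {0..T} \<Longrightarrow> f t z $ i \<le> 0"
    and h: "h integrable_on {0..T}" "\<And>t. t \<in> {0..T} \<Longrightarrow> \<epsilon> * (f0 t z - f0 t (x t)) \<le> h t"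
  shows "saddle_energy z 0 (x T) (l T) - saddle_energy z 0 (x 0) (l 0) \<le> integral {0..T} h"
proof -
  obtain N where N: "negligible N"
    "\<And>t. t \<ge> 0 \<Longrightarrow> t \<notin> N \<Longrightarrow> (x has_vector_derivative xdot t) (at t)"
    "\<And>t. t \<ge> 0 \<Longrightarrow> t \<notin> N \<Longrightarrow> (l has_vector_derivative ldot t) (at t)"
    using derivatives_ae by metis
  have E: "saddle_energy z 0 (x t) (l t) = (norm (x t - z))\<^sup>2 / 2 + (norm (l t - 0))\<^sup>2 / 2" for t
    by (simp add: saddle_energy_def add_divide_distrib)
  show ?thesis
    unfolding E
  proof (rule abs_continuous_increment_le_integral[OF _ _ N(1) _ _ h(1)])
    show "abs_continuous_on_interval 0 T (\<lambda>t. (norm (x t - z))\<^sup>2 / 2 + (norm (l t - 0))\<^sup>2 / 2)"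
      by (intro abs_continuous_on_interval_add abs_continuous_on_interval_half_sq_norm ac_x ac_l assms(1))
    fix t assume t: "t \<in> {0..T} - N"
    then show "((\<lambda>t. (norm (x t - z))\<^sup>2 / 2 + (norm (l t - 0))\<^sup>2 / 2) has_vector_derivative
        (x t - z) \<bullet> xdot t + (l t - 0) \<bullet> ldot t) (at t)"
      using N by (intro has_vector_derivative_add has_vector_derivative_half_sq_norm) auto
    have "l t \<bullet> f t z \<le> 0"
      using t feas l_nonneg by (auto simp: inner_vec_def intro!: sum_nonpos mult_nonneg_nonpos)
    then have "\<epsilon> * (l t \<bullet> f t z) \<le> 0"
      using \<epsilon> by (simp add: mult_le_0_iff)
    moreover have "(x t - z) \<bullet> xdot t \<le> \<epsilon> * (f0 t z - f0 t (x t) + l t \<bullet> (f t z - f t (x t)))"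
      using t assms by (intro inner_xdot_le) auto
    moreover have "(l t - 0) \<bullet> ldot t \<le> \<epsilon> * ((l t - 0) \<bullet> f t (x t))"
      using t by (intro inner_ldot_le) (auto simp: nonneg_orthant_def)
    ultimately show "(x t - z) \<bullet> xdot t + (l t - 0) \<bullet> ldot t \<le> h t"
      using h(2)[of t] t by (simp add: inner_diff_right algebra_simps)
  qed (use assms in auto)
qed

text \<open>The energy inequality with its exact integrand; the energy at time \<open>T\<close> is
  nonnegative and is dropped.\<close>

lemma regret_le:
  assumes "T > 0" "z \<in> X" and feas: "\<And>t i. t \<in> {0..T} \<Longrightarrow> f t z $ i \<le> 0"
  shows "integral {0..T} (\<lambda>t. f0 t (x t)) - integral {0..T} (\<lambda>t. f0 t z)
      \<le> saddle_energy z 0 (x 0) (l 0) / \<epsilon>"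
proof -
  have int: "(\<lambda>t. f0 t (x t)) integrable_on {0..T}" "(\<lambda>t. f0 t z) integrable_on {0..T}"
    using objective_absolutely_integrable[OF assms(1)] f0_int[OF assms(1,2)]
      set_lebesgue_integral_eq_integral(1) by blast+
  have "saddle_energy z 0 (x T) (l T) - saddle_energy z 0 (x 0) (l 0)
      \<le> integral {0..T} (\<lambda>t. \<epsilon> * (f0 t z - f0 t (x t)))"
    using int by (intro energy_increment_le assms integrable_on_mult_right integrable_diff) auto
  also have "\<dots> = \<epsilon> * (integral {0..T} (\<lambda>t. f0 t z) - integral {0..T} (\<lambda>t. f0 t (x t)))"
    using int by (simp add: integral_diff)
  finally have "\<epsilon> * (integral {0..T} (\<lambda>t. f0 t (x t)) - integral {0..T} (\<lambda>t. f0 t z))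
      \<le> saddle_energy z 0 (x 0) (l 0) - saddle_energy z 0 (x T) (l T)"
    by (simp add: algebra_simps)
  also have "\<dots> \<le> saddle_energy z 0 (x 0) (l 0)"
    unfolding diff_le_eq by (simp add: saddle_energy_def)
  finally show ?thesis
    using \<epsilon> by (simp add: pos_le_divide_eq mult.commute)
qed

text \<open>The energy inequality with the constant majorant \<open>\<epsilon> * K\<close>;
  subadditivity of the square root separates the initial data from the growth in
  \<open>T\<close>.\<close>

lemma multiplier_growth:
  assumes "T > 0" "z \<in> X" and feas: "\<And>t i. t \<in> {0..T} \<Longrightarrow> f t z $ i \<le> 0"
    and K: "\<And>t. t \<in> {0..T} \<Longrightarrow> f0 t z - f0 t (x t) \<le> K" and "K \<ge> 0"
  shows "norm (l T) \<le> norm (x 0 - z) + norm (l 0) + sqrt (2 * \<epsilon> * K * T)"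
proof -
  have "saddle_energy z 0 (x T) (l T) - saddle_energy z 0 (x 0) (l 0) \<le> integral {0..T} (\<lambda>t. \<epsilon> * K)"
    using K \<epsilon> by (intro energy_increment_le assms) auto
  also have "\<dots> = \<epsilon> * K * T"
    using assms(1) by simp
  finally have "(norm (l T))\<^sup>2 + (norm (x T - z))\<^sup>2 \<le> (norm (x 0 - z))\<^sup>2 + (norm (l 0))\<^sup>2 + 2 * \<epsilon> * K * T"
    by (simp add: saddle_energy_def field_simps)
  then have "(norm (l T))\<^sup>2 \<le> (norm (x 0 - z))\<^sup>2 + (norm (l 0))\<^sup>2 + 2 * \<epsilon> * K * T"
    using zero_le_power2[of "norm (x T - z)"] by linarith
  then have "norm (l T) \<le> sqrt ((norm (x 0 - z))\<^sup>2 + (norm (l 0))\<^sup>2 + 2 * \<epsilon> * K * T)"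
    by (simp add: real_le_rsqrt)
  also have "\<dots> \<le> sqrt ((norm (x 0 - z))\<^sup>2 + (norm (l 0))\<^sup>2) + sqrt (2 * \<epsilon> * K * T)"
    using assms \<epsilon> by (intro sqrt_add_le_add_sqrt) auto
  also have "\<dots> \<le> norm (x 0 - z) + norm (l 0) + sqrt (2 * \<epsilon> * K * T)"
    using sqrt_add_le_add_sqrt[of "(norm (x 0 - z))\<^sup>2" "(norm (l 0))\<^sup>2"] by simp
  finally show ?thesis .
qed

end

text \<open>The order of quantifiers expresses independence of the gain: \<open>C\<close> is fixed
  before the objective, \<open>K\<close>, \<epsilon> and the trajectory. The summand 1 beside the
  root carries the initial data, which matter even when \<open>K = 0\<close>. The integrability
  claims ensure that fit and regret are genuine integrals and not default values.\<close>

theorem theorem3: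
  fixes X :: "(real ^ 'n) set"
    and f :: "real \<Rightarrow> real ^ 'n \<Rightarrow> real ^ 'm"
    and fx :: "real \<Rightarrow> real ^ 'n \<Rightarrow> real ^ 'm ^ 'n"
    and x0 :: "real ^ 'n"
    and l0 :: "real ^ 'm"
  assumes "compact X" and "convex X"
    and "\<And>T z. T > 0 \<Longrightarrow> z \<in> X \<Longrightarrow> (\<lambda>t. f t z) absolutely_integrable_on {0..T}"
    and "\<And>t i. t \<ge> 0 \<Longrightarrow> convex_on X (\<lambda>z. f t z $ i)"
    and "\<And>t z i. t \<ge> 0 \<Longrightarrow> z \<in> X \<Longrightarrow>
           is_subgradient X (\<lambda>z. f t z $ i) z (column i (fx t z))"
    and viable: "\<exists>xd\<in>X. \<forall>t\<ge>0. \<forall>i. f t xd $ i \<le> 0"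
  shows "\<exists>C\<ge>0. \<forall>(f0 :: real \<Rightarrow> real ^ 'n \<Rightarrow> real) (f0x :: real \<Rightarrow> real ^ 'n \<Rightarrow> real ^ 'n)
           (xs :: real \<Rightarrow> real ^ 'n) (K :: real) (\<epsilon> :: real)
           (x :: real \<Rightarrow> real ^ 'n) (l :: real \<Rightarrow> real ^ 'm).
      (\<forall>T>0. \<forall>z\<in>X. (\<lambda>t. f0 t z) absolutely_integrable_on {0..T}) \<and>
      (\<forall>t\<ge>0. convex_on X (f0 t)) \<and>
      (\<forall>t\<ge>0. \<forall>z\<in>X. is_subgradient X (f0 t) z (f0x t z)) \<and>
      (\<forall>T>0. offline_solution X f f0 T (xs T)) \<and>
      (\<forall>T>0. \<forall>t\<in>{0..T}. K \<ge> f0 t (xs T) - (INF z\<in>X. f0 t z)) \<and>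
      \<epsilon> > 1 \<and>
      saddle_point_solution X f f0x fx \<epsilon> x l \<and> x 0 = x0 \<and> l 0 = l0
      \<longrightarrow>
      (\<forall>T>0. (\<lambda>t. f t (x t)) absolutely_integrable_on {0..T} \<and>
             (\<lambda>t. f0 t (x t)) absolutely_integrable_on {0..T}) \<and>
      feasible_trajectory f x \<and>
      strongly_optimal f0 xs x \<and>
      (\<forall>T>0. \<forall>i. fit f x T $ i \<le> C * (1 + sqrt (K * T))) \<and>
      (\<forall>T>0. regret f0 xs x T \<le> saddle_energy (xs T) 0 (x 0) (l 0) / \<epsilon>)"
proof -
  \<comment> \<open>The offline solution moves with the horizon; the diameter of \<open>X\<close>
    bounds its distance from the initial state uniformly.\<close>
  obtain D where "D \<ge> 0" and D: "\<And>u v. u \<in> X \<Longrightarrow> v \<in> X \<Longrightarrow> norm (u - v) \<le> D"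
  proof -
    obtain D where D: "\<forall>x\<in>X. \<forall>y\<in>X. dist x y \<le> D"
      using compact_imp_bounded[OF assms(1)] by (meson bounded_two_points)
    show thesis
      using D by (intro that[of "\<bar>D\<bar>"]) (fastforce simp: dist_norm)+
  qed
  \<comment> \<open>\<open>D + norm l0\<close> comes from the initial data, 2 from the coefficient
    of the root in the fit estimate.\<close>
  define C where "C = D + norm l0 + 2"
  have "C \<ge> 0"
    using \<open>D \<ge> 0\<close> by (simp add: C_def)
  show ?thesis
  proof (intro exI[of _ C] conjI[OF \<open>C \<ge> 0\<close>] allI impI, elim conjE)
    fix f0 :: "real \<Rightarrow> real ^ 'n \<Rightarrow> real" and f0x :: "real \<Rightarrow> real ^ 'n \<Rightarrow> real ^ 'n"
      and xs :: "real \<Rightarrow> real ^ 'n" and K \<epsilon> :: real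
      and x :: "real \<Rightarrow> real ^ 'n" and l :: "real \<Rightarrow> real ^ 'm"
    assume f0: "\<forall>T>0. \<forall>z\<in>X. (\<lambda>t. f0 t z) absolutely_integrable_on {0..T}"
        "\<forall>t\<ge>0. convex_on X (f0 t)" "\<forall>t\<ge>0. \<forall>z\<in>X. is_subgradient X (f0 t) z (f0x t z)"
      and off: "\<forall>T>0. offline_solution X f f0 T (xs T)"
      and K: "\<forall>T>0. \<forall>t\<in>{0..T}. K \<ge> f0 t (xs T) - (INF z\<in>X. f0 t z)"
      and "\<epsilon> > 1" and sol: "saddle_point_solution X f f0x fx \<epsilon> x l" and init: "x 0 = x0" "l 0 = l0"
    interpret saddle_point_trajectory X f fx f0 f0x \<epsilon> x l
      using assms f0 sol \<open>\<epsilon> > 1\<close> by unfold_locales auto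
    have xs: "xs T \<in> X" "\<And>t i. t \<in> {0..T} \<Longrightarrow> f t (xs T) $ i \<le> 0" if "T > 0" for T
      using off that by (auto simp: offline_solution_def is_arg_min_def)
    \<comment> \<open>A subgradient at \<open>y\<close> and the diameter bound \<open>f0 t\<close>
      from below, so the infimum is a true one.\<close>
    have INF_le: "(INF z\<in>X. f0 t z) \<le> f0 t y" if "t \<ge> 0" "y \<in> X" for t y
    proof (rule cINF_lower[OF _ that(2)])
      have "f0 t y - norm (f0x t y) * D \<le> f0 t z" if "z \<in> X" for z
      proof -
        have "- (norm (f0x t y) * D) \<le> - (norm (f0x t y) * norm (z - y))"
          using D[OF that \<open>y \<in> X\<close>] by (simp add: mult_left_mono)
        also have "\<dots> \<le> f0x t y \<bullet> (z - y)"
          using Cauchy_Schwarz_ineq2[of "f0x t y" "z - y"] by (simp add: abs_le_iff)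
        also have "\<dots> \<le> f0 t z - f0 t y"
          using f0_sub[OF \<open>t \<ge> 0\<close> \<open>y \<in> X\<close>] that by (simp add: is_subgradient_def algebra_simps)
        finally show ?thesis by simp
      qed
      then show "bdd_below (f0 t ` X)"
        by (auto simp: bdd_below_def)
    qed
    have K': "f0 t (xs T) - f0 t y \<le> K" if "T > 0" "t \<in> {0..T}" "y \<in> X" for T t y
      using K INF_le[of t y] that by fastforce
    \<comment> \<open>The offline solution is compared with itself.\<close>
    have "K \<ge> 0"
      using K'[of 1 0 "xs 1"] xs[of 1] by simp
    have fit: "fit f x T $ i \<le> C * (1 + sqrt (K * T))" if "T > 0" for T i
    proof -
      have "\<epsilon> * fit f x T $ i \<le> l T $ i"
        using fit_le[OF that, of i] l_nonneg[of 0 i] by simp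
      also have "\<dots> \<le> norm (l T)"
        using component_le_norm_cart[of "l T" i] by simp
      also have "\<dots> \<le> norm (x 0 - xs T) + norm (l 0) + sqrt (2 * \<epsilon> * K * T)"
        using xs[OF that] K'[OF that] x_in \<open>K \<ge> 0\<close> that by (intro multiplier_growth) auto
      also have "\<dots> \<le> D + norm l0 + sqrt (2 * \<epsilon> * K * T)"
        using D[OF x_in xs(1)[OF that], of 0] init by simp
      \<comment> \<open>As \<epsilon> > 1, \<open>2 * \<epsilon>\<close> is at most its square. A
        full factor \<epsilon> thus leaves the root and cancels the one in front of the fit.\<close>
      also have "sqrt (2 * \<epsilon> * K * T) \<le> sqrt ((2 * \<epsilon>)\<^sup>2 * (K * T))"
      proof (rule real_sqrt_le_mono)
        have "(2 * \<epsilon>) * (K * T) \<le> (2 * \<epsilon>)\<^sup>2 * (K * T)"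
          using \<open>\<epsilon> > 1\<close> \<open>K \<ge> 0\<close> that by (intro mult_right_mono) (auto simp: power2_eq_square)
        then show "2 * \<epsilon> * K * T \<le> (2 * \<epsilon>)\<^sup>2 * (K * T)"
          by (simp add: mult.assoc)
      qed
      also have "\<dots> = \<epsilon> * (2 * sqrt (K * T))"
        using \<open>\<epsilon> > 1\<close> by (simp add: real_sqrt_mult)
      also have "D + norm l0 \<le> \<epsilon> * (D + norm l0)"
        using \<open>\<epsilon> > 1\<close> \<open>D \<ge> 0\<close> mult_right_mono[of 1 \<epsilon> "D + norm l0"] by simp
      finally have "\<epsilon> * fit f x T $ i \<le> \<epsilon> * (D + norm l0 + 2 * sqrt (K * T))"
        by (simp add: algebra_simps)
      then have "fit f x T $ i \<le> D + norm l0 + 2 * sqrt (K * T)"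
        using \<open>\<epsilon> > 1\<close> by simp
      also have "\<dots> \<le> C * (1 + sqrt (K * T))"
      proof -
        have "0 \<le> (D + norm l0) * sqrt (K * T)"
          using \<open>K \<ge> 0\<close> \<open>D \<ge> 0\<close> that by simp
        then show ?thesis
          by (simp add: C_def algebra_simps)
      qed
      finally show ?thesis .
    qed
    have reg: "regret f0 xs x T \<le> saddle_energy (xs T) 0 (x 0) (l 0) / \<epsilon>" if "T > 0" for T
      unfolding regret_def using xs[OF that] that by (intro regret_le)
    have feas: "feasible_trajectory f x"
      unfolding feasible_trajectory_def
    \<comment> \<open>The witnesses, fixed by the goals below, are \<open>1 + sqrt (K * T)\<close>
      and the vector with all entries \<open>C\<close>.\<close>
    proof (intro exI conjI allI impI)
      have "((\<lambda>T. (1 + sqrt (K * T)) / T) \<longlongrightarrow> 0) at_top"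
      proof (rule Lim_transform_eventually)
        have "((\<lambda>T. 1 / T + sqrt K * (1 / sqrt T)) \<longlongrightarrow> 0 + sqrt K * 0) at_top"
          by (intro tendsto_intros tendsto_divide_0[OF tendsto_const] filterlim_at_top_imp_at_infinity
              filterlim_ident sqrt_at_top)
        then show "((\<lambda>T. 1 / T + sqrt K * (1 / sqrt T)) \<longlongrightarrow> 0) at_top"
          by simp
        show "\<forall>\<^sub>F T in at_top. 1 / T + sqrt K * (1 / sqrt T) = (1 + sqrt (K * T)) / T"
          using eventually_gt_at_top[of 0]
        proof eventually_elim
          case (elim T)
          then have "sqrt T / T = 1 / sqrt T"
            using sqrt_divide_self_eq[of T] by (simp only: inverse_eq_divide less_imp_le)
          then have "sqrt (K * T) / T = sqrt K * (1 / sqrt T)"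
            by (metis real_sqrt_mult times_divide_eq_right)
          then show ?case
            by (simp only: add_divide_distrib)
        qed
      qed
      then have "((\<lambda>T. ereal ((1 + sqrt (K * T)) / T)) \<longlongrightarrow> ereal 0) at_top"
        by simp
      then show "Limsup at_top (\<lambda>T. ereal ((1 + sqrt (K * T)) / T)) = 0"
        by (simp add: lim_imp_Limsup zero_ereal_def)
      show "fit f x T $ i \<le> (\<chi> i. C) $ i * (1 + sqrt (K * T))" if "T > 0" for T i
        using fit[OF that] by simp
    qed
    have opt: "strongly_optimal f0 xs x"
      unfolding strongly_optimal_def
    proof (intro exI allI impI)
      fix T :: real assume "T > 0"
      \<comment> \<open>\<open>xs T\<close> varies with the horizon, so the energy is replaced by a
        bound independent of \<open>T\<close>.\<close>
      have "norm (x 0 - xs T) \<le> D"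
        using D x_in xs(1)[OF \<open>T > 0\<close>] by simp
      then have "saddle_energy (xs T) 0 (x 0) (l 0) \<le> (D\<^sup>2 + (norm l0)\<^sup>2) / 2"
        unfolding saddle_energy_def init by (simp add: power_mono)
      then have "saddle_energy (xs T) 0 (x 0) (l 0) / \<epsilon> \<le> (D\<^sup>2 + (norm l0)\<^sup>2) / 2 / \<epsilon>"
        using \<open>\<epsilon> > 1\<close> by (intro divide_right_mono) auto
      then show "regret f0 xs x T \<le> (D\<^sup>2 + (norm l0)\<^sup>2) / 2 / \<epsilon>"
        using reg[OF \<open>T > 0\<close>] by linarith
    qed
    show "(\<forall>T>0. (\<lambda>t. f t (x t)) absolutely_integrable_on {0..T} \<and>
             (\<lambda>t. f0 t (x t)) absolutely_integrable_on {0..T}) \<and>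
      feasible_trajectory f x \<and> strongly_optimal f0 xs x \<and>
      (\<forall>T>0. \<forall>i. fit f x T $ i \<le> C * (1 + sqrt (K * T))) \<and>
      (\<forall>T>0. regret f0 xs x T \<le> saddle_energy (xs T) 0 (x 0) (l 0) / \<epsilon>)"
      using constraint_absolutely_integrable objective_absolutely_integrable feas opt fit reg by simp
  qed
qed

end
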